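(* Let $k=k(n)$ be any sequence of integers with $2\le k\le n/(2\log n)$. Then the distribution of $X_{n,k}$ is asymptotically Gaussian as $n\to\infty$, i.e. $$\frac{X_{n,k}-\mathrm{E}(X_{n,k})}{\sqrt{\mathrm{Var}(X_{n,k})}}\longrightarrow\mathcal N(0,1)\quad\text{in distribution as } n\to\infty,$$ where $\mathcal N(0,1)$ is the standard normal distribution.
   Context: $[n]=\{1,\dots,n\}$ and $\Pi_n^k$ is the set of all partitions of $[n]$ into $k$ (nonempty) blocks. For a set partition $\pi$ of $[n]$, the arcs of its linear representation are the pairs $(i,j)$, $i<j$, where $i,j$ are consecutive elements (in increasing order) of the same block; $\mathrm{cr}^{(\ell)}(\pi)$ is the number of (unordered) pairs of crossing arcs, i.e. pairs of arcs $(i,j),(i',j')$ with $i<i'<j<j'$. $X_{n,k}$ is the random variable equal to $\mathrm{cr}^{(\ell)}(\pi)$ for $\pi$ uniformly distributed on $\Pi_n^k$. *)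

theory Defs
  imports "HOL-Probability.Probability"
begin

definition set_partitions :: "nat \<Rightarrow> nat \<Rightarrow> nat set set set" where
  "set_partitions n k = {P. partition_on {1..n} P \<and> card P = k}"

definition arcs :: "nat set set \<Rightarrow> (nat \<times> nat) set" where
  "arcs P = {(i, j). i < j \<and> (\<exists>B\<in>P. i \<in> B \<and> j \<in> B \<and> (\<forall>m\<in>B. \<not> (i < m \<and> m < j)))}"

text \<open>The inequality \<open>i < i'\<close> orders the two arcs of a crossing, so each unordered pair
  of crossing arcs is counted exactly once.\<close>

definition linear_crossings :: "nat set set \<Rightarrow> nat" where
  "linear_crossings P =
     card {((i, j), (i', j')). (i, j) \<in> arcs P \<and> (i', j') \<in> arcs P \<and> i < i' \<and> i' < j \<and> j < j'}"

text \<open>\<open>pmf_of_set\<close> is the uniform distribution only on a finite nonempty set; see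
  \<open>finite_set_partitions\<close> and \<open>set_partitions_nonempty\<close> below.\<close>

definition uniform_set_partition :: "nat \<Rightarrow> nat \<Rightarrow> nat set set pmf" where
  "uniform_set_partition n k = pmf_of_set (set_partitions n k)"

lemma finite_set_partitions: "finite (set_partitions n k)"
proof (rule finite_subset)
  show "set_partitions n k \<subseteq> Pow (Pow {1..n})"
    by (auto simp: set_partitions_def partition_on_def)
qed simp

lemma set_partitions_nonempty:
  assumes "1 \<le> k" "k \<le> n"
  shows "set_partitions n k \<noteq> {}"
proof -
  define P where "P = insert {k..n} ((\<lambda>i. {i}) ` {1..<k})"
  have "\<Union>P = {1..n}"
    using assms by (auto simp: P_def)
  moreover have "disjoint P"
    by (auto simp: P_def pairwise_def disjnt_def)
  moreover have "{} \<notin> P"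
    using assms by (auto simp: P_def)
  ultimately have "partition_on {1..n} P"
    by (simp add: partition_on_def)
  moreover have "{k..n} \<notin> (\<lambda>i. {i}) ` {1..<k}"
  proof
    assume "{k..n} \<in> (\<lambda>i. {i}) ` {1..<k}"
    then obtain i where "i < k" "{k..n} = {i}" by auto
    moreover have "k \<in> {k..n}" using assms by simp
    ultimately show False by auto
  qed
  hence "card P = k"
    using assms by (simp add: P_def card_insert_if card_image inj_on_def)
  ultimately show ?thesis
    by (auto simp: set_partitions_def)
qed

end

theory Submission
  imports Defs
begin

text \<open>
  A uniformly random word of length \<open>n\<close> over \<open>{0..<k}\<close>, conditioned on using every letter, cuts \<open>{1..n}\<close>
  into \<open>k\<close> letter classes, and the resulting partition is uniform because every partition arises from
  exactly \<open>k!\<close> words (\<open>avg_onto_words_fibers\<close>). The condition \<open>k \<le> n / (2 * ln n)\<close> makes this conditioning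
  harmless: a letter is omitted with probability at most \<open>k * (1 - 1/k)^n \<le> k / n\<^sup>2\<close>.

  Keep the letters in a move-to-front list while the word is read. When a letter \<open>c\<close> is read again, the
  letters ahead of it in the list are those that occurred since the last \<open>c\<close>. Such a letter \<open>b\<close> has an arc
  over that last \<open>c\<close>, crossing the arc of \<open>c\<close> that is just being closed, unless \<open>b\<close> had not
  occurred before. So the number of crossings is nearly the sum \<open>S\<close> of the move-to-front positions of the
  letters read. The exact relation is \<open>crossings_eq_mtf_sum\<close>. For words using all \<open>k\<close> letters it says
    \<open>crossings = S + N - J - 5/4 * k * (k - 1)\<close>,
  where \<open>N\<close> counts the pairs of letters such that all occurrences of the first precede all occurrences of
  the second, and \<open>J\<close> is the centred number of inversions of the order in which the letters first appear.

  Whatever has been read, the map from the next letter to its position in the list is a permutation.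
  Hence \<open>S\<close> is a sum of \<open>n\<close> independent variables uniform on \<open>{0..<k}\<close>; its variance is
  \<open>n * (k\<^sup>2 - 1) / 12\<close> and it is asymptotically normal (\<open>avg_iexp_mtf_dev_tendsto\<close>). The other two terms are
  small in mean square: \<open>E J\<^sup>2 \<le> k^3 / 4\<close> by a martingale argument (\<open>avg_new_noise_square_le\<close>), and
  \<open>E N\<^sup>2 \<le> k^4 * (n + 1) / n\<^sup>2\<close> by counting the words with a separated pair of letters
  (\<open>avg_card_separated_square_le\<close>). Relative to the variance of \<open>S\<close> both are \<open>O(k / n)\<close>, which tends to 0.

  Closeness in mean square is what the theorem requires, because the crossing number is standardized by
  its own mean and variance: it carries the first two moments and the characteristic function over from
  \<open>S\<close> (\<open>standardized_iexp_tendsto\<close>). Levy's continuity theorem finishes the proof.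
\<close>

section \<open>Averages over finite sets\<close>

text \<open>
  A uniform distribution on a finite set is handled as a plain average, so that no integrability has to
  be discharged. The codomain covers moments (real) and characteristic functions (complex).
\<close>

definition avg :: "'a set \<Rightarrow> ('a \<Rightarrow> 'b::real_normed_field) \<Rightarrow> 'b" where
  "avg A f = sum f A / of_nat (card A)"

lemma avg_cong: "(\<And>x. x \<in> A \<Longrightarrow> f x = g x) \<Longrightarrow> avg A f = avg A g"
  unfolding avg_def by (simp cong: sum.cong)

lemma avg_add: "avg A (\<lambda>x. f x + g x) = avg A f + avg A g"
  by (simp add: avg_def sum.distrib add_divide_distrib)

lemma avg_diff: "avg A (\<lambda>x. f x - g x) = avg A f - avg A g"
  by (simp add: avg_def sum_subtractf diff_divide_distrib)

lemma avg_cmult: "avg A (\<lambda>x. c * f x) = c * avg A f"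
  by (simp add: avg_def sum_distrib_left)

lemma avg_multc: "avg A (\<lambda>x. f x * c) = avg A f * c"
  by (simp add: avg_def sum_distrib_right)

lemma avg_divide: "avg A (\<lambda>x. f x / c) = avg A f / c"
  using avg_multc[of A f "inverse c"] by (simp add: field_simps)

lemma avg_const: "finite A \<Longrightarrow> A \<noteq> {} \<Longrightarrow> avg A (\<lambda>_. c) = c"
  by (simp add: avg_def)

lemma avg_mono:
  fixes f g :: "'a \<Rightarrow> real"
  shows "(\<And>x. x \<in> A \<Longrightarrow> f x \<le> g x) \<Longrightarrow> avg A f \<le> avg A g"
  by (simp add: avg_def divide_right_mono sum_mono)

lemma avg_nonneg:
  fixes f :: "'a \<Rightarrow> real"
  shows "(\<And>x. x \<in> A \<Longrightarrow> 0 \<le> f x) \<Longrightarrow> 0 \<le> avg A f"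
  by (simp add: avg_def sum_nonneg)

lemma norm_avg_le: "norm (avg A f) \<le> avg A (\<lambda>x. norm (f x))"
  by (simp add: avg_def norm_divide divide_right_mono norm_sum)

lemma norm_avg_le_bound:
  assumes "finite A" "A \<noteq> {}" "\<And>x. x \<in> A \<Longrightarrow> norm (f x) \<le> B"
  shows "norm (avg A f) \<le> B"
proof -
  have "norm (avg A f) \<le> avg A (\<lambda>x. norm (f x))" by (rule norm_avg_le)
  also have "\<dots> \<le> avg A (\<lambda>_. B)" using assms by (intro avg_mono) auto
  finally show ?thesis using assms by (simp add: avg_const)
qed

lemma avg_Cauchy_Schwarz:
  fixes f g :: "'a \<Rightarrow> real"
  shows "(avg A (\<lambda>x. f x * g x))\<^sup>2 \<le> avg A (\<lambda>x. (f x)\<^sup>2) * avg A (\<lambda>x. (g x)\<^sup>2)"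
proof -
  have "(\<Sum>x\<in>A. f x * g x)\<^sup>2 / (real (card A))\<^sup>2
      \<le> ((\<Sum>x\<in>A. (f x)\<^sup>2) * (\<Sum>x\<in>A. (g x)\<^sup>2)) / (real (card A))\<^sup>2"
    by (intro divide_right_mono Cauchy_Schwarz_ineq_sum) simp
  thus ?thesis by (simp add: avg_def power_divide power2_eq_square)
qed

lemma avg_power2_le:
  fixes f :: "'a \<Rightarrow> real"
  assumes "finite A" "A \<noteq> {}"
  shows "(avg A f)\<^sup>2 \<le> avg A (\<lambda>x. (f x)\<^sup>2)"
  using avg_Cauchy_Schwarz[of A f "\<lambda>_. 1"] avg_const[OF assms, of "1::real"] by simp

lemma avg_abs_le_sqrt:
  fixes f :: "'a \<Rightarrow> real"
  assumes "finite A" "A \<noteq> {}"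
  shows "avg A (\<lambda>x. \<bar>f x\<bar>) \<le> sqrt (avg A (\<lambda>x. (f x)\<^sup>2))"
  using avg_power2_le[OF assms, of "\<lambda>x. \<bar>f x\<bar>"] by (intro real_le_rsqrt) simp

text \<open>
  Conditioning on a likely event hardly changes the mean of a bounded function: the average over \<open>W\<close> is
  the convex combination of the averages over \<open>A\<close> and over \<open>W - A\<close>, both of norm at most \<open>B\<close>.
\<close>

lemma avg_subset_diff_le:
  fixes f :: "'a \<Rightarrow> 'b::real_normed_field"
  assumes fin: "finite W" and sub: "A \<subseteq> W" and ne: "A \<noteq> {}"
    and B: "\<And>x. x \<in> W \<Longrightarrow> norm (f x) \<le> B"
  shows "norm (avg A f - avg W f) \<le> 2 * B * (real (card (W - A)) / real (card W))"
proof -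
  have finA: "finite A" using fin sub finite_subset by blast
  have W: "card W > 0" "card A > 0" using fin ne sub finA by (auto simp: card_gt_0_iff)
  have cards: "card W = card A + card (W - A)"
    using card_Diff_subset[OF finA sub] card_mono[OF fin sub] by simp
  have sums: "sum f W = sum f A + sum f (W - A)"
    using sum.subset_diff[OF sub fin, of f] by (simp add: add.commute)
  have avgW: "of_nat (card W) * avg W f = sum f W" and avgA: "of_nat (card A) * avg A f = sum f A"
    using W by (simp_all add: avg_def)
  have "of_nat (card W) * (avg A f - avg W f)
      = of_nat (card A) * avg A f + of_nat (card (W - A)) * avg A f - of_nat (card W) * avg W f"
    unfolding cards by (simp add: algebra_simps)
  also have "\<dots> = of_nat (card (W - A)) * avg A f - sum f (W - A)"
    unfolding avgW avgA sums by simp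
  finally have "of_nat (card W) * (avg A f - avg W f) = of_nat (card (W - A)) * avg A f - sum f (W - A)" .
  hence "real (card W) * norm (avg A f - avg W f)
      = norm (of_nat (card (W - A)) * avg A f - sum f (W - A))"
    by (metis norm_mult norm_of_nat)
  also have "\<dots> \<le> real (card (W - A)) * norm (avg A f) + norm (sum f (W - A))"
    by (metis norm_mult norm_of_nat norm_triangle_ineq4)
  also have "\<dots> \<le> real (card (W - A)) * B + real (card (W - A)) * B"
    using norm_avg_le_bound[OF finA ne, of f B] B sub
    by (intro add_mono mult_left_mono sum_norm_bound) auto
  finally show ?thesis using W by (simp add: field_simps)
qed

text \<open>
  The companion of the previous estimate for error terms, which are small on average but have no useful
  pointwise bound.
\<close>

lemma avg_subset_le:
  fixes f :: "'a \<Rightarrow> real"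
  assumes "finite W" "A \<subseteq> W" "A \<noteq> {}" "card W \<le> 2 * card A" "\<And>x. x \<in> W \<Longrightarrow> 0 \<le> f x"
  shows "avg A f \<le> 2 * avg W f"
proof -
  have "finite A" using assms finite_subset by blast
  hence pos: "card A > 0" "card W > 0" using assms by (auto simp: card_gt_0_iff)
  have "avg A f \<le> sum f W / real (card A)"
    unfolding avg_def using assms by (intro divide_right_mono sum_mono2) auto
  also have "\<dots> \<le> sum f W / (real (card W) / 2)"
    using assms(4,5) pos by (intro divide_left_mono sum_nonneg mult_pos_pos) auto
  finally show ?thesis by (simp add: avg_def mult.commute)
qed

lemma cmod_iexp_diff_le: "cmod (iexp x - iexp y) \<le> \<bar>x - y\<bar>"
proof -
  have "iexp x - iexp y = iexp y * (iexp (x - y) - 1)"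
    by (simp add: algebra_simps exp_add[symmetric] flip: exp_add)
  hence "cmod (iexp x - iexp y) = cmod (iexp (x - y) - 1)"
    by (simp add: norm_mult)
  thus ?thesis using iexp_approx1[of "x - y" 0] by simp
qed

text \<open>
  Second-order Taylor expansion of the characteristic function of a centred bounded variable.
\<close>

lemma avg_iexp_approx:
  fixes x :: "'a \<Rightarrow> real"
  assumes "finite B" "B \<noteq> {}" and mean: "avg B x = 0" and bound: "\<And>u. u \<in> B \<Longrightarrow> \<bar>x u\<bar> \<le> b"
  shows "cmod (avg B (\<lambda>u. iexp (x u)) - of_real (1 - avg B (\<lambda>u. (x u)\<^sup>2) / 2)) \<le> b ^ 3 / 6"
proof -
  have of_real_avg: "of_real (avg B g) = avg B (\<lambda>u. complex_of_real (g u))" for g :: "'a \<Rightarrow> real"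
    by (simp add: avg_def)
  have "avg B (\<lambda>u. iexp (x u)) - of_real (1 - avg B (\<lambda>u. (x u)\<^sup>2) / 2)
      = avg B (\<lambda>u. iexp (x u)) - (of_real 1 + \<i> * of_real (avg B x) - of_real (avg B (\<lambda>u. (x u)\<^sup>2)) / 2)"
    by (simp add: mean)
  also have "\<dots> = avg B (\<lambda>u. iexp (x u) - (1 + \<i> * of_real (x u) - of_real ((x u)\<^sup>2) / 2))"
    unfolding of_real_avg using assms(1,2) by (simp only: avg_diff avg_add avg_cmult avg_divide avg_const of_real_1 not_False_eq_True)
  also have "cmod \<dots> \<le> b ^ 3 / 6"
  proof (rule norm_avg_le_bound[OF assms(1,2)])
    fix u assume u: "u \<in> B"
    have "{..2::nat} = {0, 1, 2}" by auto
    hence "(\<Sum>k\<le>2. (\<i> * of_real (x u)) ^ k / fact k) = 1 + \<i> * of_real (x u) - of_real ((x u)\<^sup>2) / 2"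
      by (simp add: power_mult_distrib)
    moreover have "Suc 2 = 3" "fact 3 = (6::real)" by (simp_all add: fact_numeral)
    ultimately have "cmod (iexp (x u) - (1 + \<i> * of_real (x u) - of_real ((x u)\<^sup>2) / 2)) \<le> \<bar>x u\<bar> ^ 3 / 6"
      using iexp_approx1[of "x u" 2] by metis
    also have "\<dots> \<le> b ^ 3 / 6"
      using bound[OF u] by (intro divide_right_mono power_mono) auto
    finally show "cmod (iexp (x u) - (1 + \<i> * of_real (x u) - of_real ((x u)\<^sup>2) / 2)) \<le> b ^ 3 / 6" .
  qed
  finally show ?thesis .
qed

text \<open>
  A form of Slutsky's theorem adapted to standardization by the exact mean and variance. Convergence in
  probability of \<open>(X - c) / s - T\<close> to 0 would not control the moments of \<open>X\<close>; convergence in mean square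
  does. If \<open>Z = (X - c) / s\<close> then \<open>E Z\<close> tends to 0 and \<open>Var Z\<close> to 1, so the standardization \<open>W\<close> of \<open>Z\<close>, which is
  also that of \<open>X\<close>, satisfies \<open>E \<bar>W - T\<bar> \<rightarrow> 0\<close>, and \<open>\<bar>exp (i t W) - exp (i t T)\<bar> \<le> \<bar>t\<bar> * \<bar>W - T\<bar>\<close>.
\<close>

lemma standardized_iexp_tendsto:
  fixes A :: "nat \<Rightarrow> 'a set" and X T :: "nat \<Rightarrow> 'a \<Rightarrow> real" and s c :: "nat \<Rightarrow> real"
  assumes ev: "\<forall>\<^sub>F n in sequentially. finite (A n) \<and> A n \<noteq> {} \<and> s n > 0"
    and err: "(\<lambda>n. avg (A n) (\<lambda>x. ((X n x - c n) / s n - T n x)\<^sup>2)) \<longlonglongrightarrow> 0"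
    and mean: "(\<lambda>n. avg (A n) (T n)) \<longlonglongrightarrow> 0"
    and second: "(\<lambda>n. avg (A n) (\<lambda>x. (T n x)\<^sup>2)) \<longlonglongrightarrow> 1"
    and char: "(\<lambda>n. avg (A n) (\<lambda>x. iexp (t * T n x))) \<longlonglongrightarrow> L"
  shows "(\<lambda>n. avg (A n) (\<lambda>x. iexp (t * ((X n x - avg (A n) (X n))
            / sqrt (avg (A n) (\<lambda>x. (X n x - avg (A n) (X n))\<^sup>2)))))) \<longlonglongrightarrow> L"
proof -
  define Z where "Z n x = (X n x - c n) / s n" for n x
  define \<delta> where "\<delta> n = avg (A n) (\<lambda>x. (Z n x - T n x)\<^sup>2)" for n
  define m where "m n = avg (A n) (Z n)" for n
  define v where "v n = avg (A n) (\<lambda>x. (Z n x - m n)\<^sup>2)" for n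
  define W where "W n x = (Z n x - m n) / sqrt (v n)" for n x
  have \<delta>: "\<delta> \<longlonglongrightarrow> 0" using err by (simp add: \<delta>_def[abs_def] Z_def)
  hence sqrt\<delta>: "(\<lambda>n. sqrt (\<delta> n)) \<longlonglongrightarrow> 0" using tendsto_real_sqrt by fastforce
  have \<delta>_nonneg: "\<delta> n \<ge> 0" for n by (simp add: \<delta>_def avg_nonneg)
  have v_nonneg: "v n \<ge> 0" for n by (simp add: v_def avg_nonneg)
  have diff_avg: "(\<lambda>n. avg (A n) (\<lambda>x. Z n x - T n x)) \<longlonglongrightarrow> 0"
  proof (rule Lim_null_comparison[OF _ sqrt\<delta>])
    show "\<forall>\<^sub>F n in sequentially. norm (avg (A n) (\<lambda>x. Z n x - T n x)) \<le> sqrt (\<delta> n)"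
      using ev
    proof eventually_elim
      case (elim n)
      have "norm (avg (A n) (\<lambda>x. Z n x - T n x)) \<le> avg (A n) (\<lambda>x. \<bar>Z n x - T n x\<bar>)"
        using norm_avg_le[of "A n" "\<lambda>x. Z n x - T n x"] by simp
      also have "\<dots> \<le> sqrt (\<delta> n)" using elim by (auto simp: \<delta>_def intro: avg_abs_le_sqrt)
      finally show ?case .
    qed
  qed
  have m: "m \<longlonglongrightarrow> 0"
    using tendsto_add[OF diff_avg mean] by (simp add: avg_diff m_def[abs_def])
  have cross: "(\<lambda>n. avg (A n) (\<lambda>x. (Z n x - T n x) * T n x)) \<longlonglongrightarrow> 0"
  proof (rule Lim_null_comparison[OF _ ])
    show "(\<lambda>n. sqrt (\<delta> n * avg (A n) (\<lambda>x. (T n x)\<^sup>2))) \<longlonglongrightarrow> 0"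
      using tendsto_real_sqrt[OF tendsto_mult[OF \<delta> second]] by simp
    show "\<forall>\<^sub>F n in sequentially. norm (avg (A n) (\<lambda>x. (Z n x - T n x) * T n x))
        \<le> sqrt (\<delta> n * avg (A n) (\<lambda>x. (T n x)\<^sup>2))"
      unfolding \<delta>_def real_norm_def
      by (intro always_eventually allI real_le_rsqrt) (simp add: avg_Cauchy_Schwarz)
  qed
  \<comment> \<open>Expand \<open>Z = (Z - T) + T\<close>; the cross term vanishes in the limit by Cauchy-Schwarz.\<close>
  have v_eq: "v n = \<delta> n + 2 * avg (A n) (\<lambda>x. (Z n x - T n x) * T n x)
       + avg (A n) (\<lambda>x. (T n x)\<^sup>2) - (m n)\<^sup>2" if "finite (A n) \<and> A n \<noteq> {} \<and> s n > 0" for n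
  proof -
    have "v n = avg (A n) (\<lambda>x. (Z n x)\<^sup>2 - 2 * m n * Z n x + (m n)\<^sup>2)"
      unfolding v_def by (intro avg_cong) (simp add: power2_eq_square algebra_simps)
    also have "\<dots> = avg (A n) (\<lambda>x. (Z n x)\<^sup>2) - (m n)\<^sup>2"
      using that by (simp add: avg_add avg_diff avg_cmult avg_const m_def power2_eq_square)
    also have "avg (A n) (\<lambda>x. (Z n x)\<^sup>2) = avg (A n) (\<lambda>x. (Z n x - T n x)\<^sup>2
        + 2 * ((Z n x - T n x) * T n x) + (T n x)\<^sup>2)"
      by (intro avg_cong) (simp add: power2_eq_square algebra_simps)
    finally show ?thesis by (simp add: \<delta>_def avg_add avg_cmult)
  qed
  have veq: "\<forall>\<^sub>F n in sequentially. \<delta> n + 2 * avg (A n) (\<lambda>x. (Z n x - T n x) * T n x)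
       + avg (A n) (\<lambda>x. (T n x)\<^sup>2) - (m n)\<^sup>2 = v n"
    using ev by (rule eventually_mono) (simp add: v_eq)
  have "(\<lambda>n. \<delta> n + 2 * avg (A n) (\<lambda>x. (Z n x - T n x) * T n x)
       + avg (A n) (\<lambda>x. (T n x)\<^sup>2) - (m n)\<^sup>2) \<longlonglongrightarrow> 0 + 2 * 0 + 1 - 0\<^sup>2"
    by (intro tendsto_intros \<delta> cross second m)
  hence v: "v \<longlonglongrightarrow> 1" using Lim_transform_eventually[OF _ veq] by simp
  hence sqrtv: "(\<lambda>n. sqrt (v n)) \<longlonglongrightarrow> 1" using tendsto_real_sqrt by fastforce
  have vpos: "\<forall>\<^sub>F n in sequentially. v n > 0" using order_tendstoD(1)[OF v, of 0] by simp
  have W_diff: "(\<lambda>n. avg (A n) (\<lambda>x. iexp (t * W n x)) - avg (A n) (\<lambda>x. iexp (t * T n x))) \<longlonglongrightarrow> 0"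
  proof (rule Lim_null_comparison)
    have "(\<lambda>n. \<bar>t\<bar> * (\<bar>1 - sqrt (v n)\<bar> + sqrt (\<delta> n) + \<bar>m n\<bar>)) \<longlonglongrightarrow> \<bar>t\<bar> * (\<bar>1 - 1\<bar> + 0 + \<bar>0\<bar>)"
      by (intro tendsto_intros sqrtv sqrt\<delta> m)
    thus "(\<lambda>n. \<bar>t\<bar> * (\<bar>1 - sqrt (v n)\<bar> + sqrt (\<delta> n) + \<bar>m n\<bar>)) \<longlonglongrightarrow> 0" by simp
    show "\<forall>\<^sub>F n in sequentially.
        norm (avg (A n) (\<lambda>x. iexp (t * W n x)) - avg (A n) (\<lambda>x. iexp (t * T n x)))
        \<le> \<bar>t\<bar> * (\<bar>1 - sqrt (v n)\<bar> + sqrt (\<delta> n) + \<bar>m n\<bar>)"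
      using ev vpos
    proof eventually_elim
      case (elim n)
      have fin: "finite (A n)" "A n \<noteq> {}" using elim by auto
      have "norm (avg (A n) (\<lambda>x. iexp (t * W n x)) - avg (A n) (\<lambda>x. iexp (t * T n x)))
          \<le> avg (A n) (\<lambda>x. cmod (iexp (t * W n x) - iexp (t * T n x)))"
        by (simp only: avg_diff[symmetric] norm_avg_le)
      also have "\<dots> \<le> avg (A n) (\<lambda>x. \<bar>t\<bar> * (\<bar>1 - sqrt (v n)\<bar> / sqrt (v n) * \<bar>Z n x - m n\<bar>
           + \<bar>Z n x - T n x\<bar> + \<bar>m n\<bar>))"
      proof (rule avg_mono)
        fix x
        have "cmod (iexp (t * W n x) - iexp (t * T n x)) \<le> \<bar>t * W n x - t * T n x\<bar>"
          by (rule cmod_iexp_diff_le)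
        also have "\<dots> = \<bar>t\<bar> * \<bar>W n x - T n x\<bar>"
          by (simp add: abs_mult[symmetric] algebra_simps)
        \<comment> \<open>Rescaling \<open>Z - m\<close> to unit variance and moving from \<open>Z - m\<close> to \<open>T\<close> are charged separately.\<close>
        also have "W n x - T n x
            = (1 - sqrt (v n)) / sqrt (v n) * (Z n x - m n) + (Z n x - T n x) - m n"
          using elim by (simp add: W_def field_simps)
        also have "\<bar>\<dots>\<bar> \<le> \<bar>(1 - sqrt (v n)) / sqrt (v n) * (Z n x - m n)\<bar> + \<bar>Z n x - T n x\<bar> + \<bar>m n\<bar>"
          by linarith
        also have "\<bar>(1 - sqrt (v n)) / sqrt (v n) * (Z n x - m n)\<bar>
            = \<bar>1 - sqrt (v n)\<bar> / sqrt (v n) * \<bar>Z n x - m n\<bar>"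
          using elim by (simp add: abs_mult)
        finally show "cmod (iexp (t * W n x) - iexp (t * T n x))
            \<le> \<bar>t\<bar> * (\<bar>1 - sqrt (v n)\<bar> / sqrt (v n) * \<bar>Z n x - m n\<bar> + \<bar>Z n x - T n x\<bar> + \<bar>m n\<bar>)"
          by (simp add: mult_left_mono)
      qed
      also have "\<dots> = \<bar>t\<bar> * (\<bar>1 - sqrt (v n)\<bar> / sqrt (v n) * avg (A n) (\<lambda>x. \<bar>Z n x - m n\<bar>)
           + avg (A n) (\<lambda>x. \<bar>Z n x - T n x\<bar>) + \<bar>m n\<bar>)"
        using fin by (simp only: avg_add avg_cmult avg_const not_False_eq_True)
      also have "\<dots> \<le> \<bar>t\<bar> * (\<bar>1 - sqrt (v n)\<bar> / sqrt (v n) * sqrt (v n) + sqrt (\<delta> n) + \<bar>m n\<bar>)"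
        unfolding v_def[of n] \<delta>_def
        by (intro mult_left_mono add_mono avg_abs_le_sqrt fin order_refl divide_nonneg_nonneg
             real_sqrt_ge_zero avg_nonneg) auto
      finally show ?case using elim by simp
    qed
  qed
  have lim: "(\<lambda>n. avg (A n) (\<lambda>x. iexp (t * W n x))) \<longlonglongrightarrow> L"
    using tendsto_add[OF W_diff char] by simp
  have "\<forall>\<^sub>F n in sequentially. avg (A n) (\<lambda>x. iexp (t * W n x)) =
     avg (A n) (\<lambda>x. iexp (t * ((X n x - avg (A n) (X n))
            / sqrt (avg (A n) (\<lambda>x. (X n x - avg (A n) (X n))\<^sup>2)))))"
    using ev
  proof eventually_elim
    case (elim n)
    have "m n = (avg (A n) (X n) - c n) / s n"
      using elim by (simp add: m_def Z_def[abs_def] avg_divide avg_diff avg_const)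
    hence Zm: "Z n x - m n = (X n x - avg (A n) (X n)) / s n" for x
      by (simp add: Z_def diff_divide_distrib)
    have "v n = avg (A n) (\<lambda>x. (X n x - avg (A n) (X n))\<^sup>2) / (s n)\<^sup>2"
      by (simp add: v_def Zm power_divide avg_divide)
    hence "W n x = (X n x - avg (A n) (X n)) / sqrt (avg (A n) (\<lambda>x. (X n x - avg (A n) (X n))\<^sup>2))" for x
      using elim by (simp add: W_def Zm real_sqrt_divide)
    thus ?case by simp
  qed
  thus ?thesis by (rule Lim_transform_eventually[OF lim])
qed

section \<open>Uniform random words\<close>

text \<open>
  A word is stored with its latest letter first, so that reading one more letter is \<open>Cons\<close> and the
  quantities attached to a word are defined by recursion over time.
\<close>

definition words :: "nat \<Rightarrow> nat \<Rightarrow> nat list set" where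
  "words n k = {w. length w = n \<and> set w \<subseteq> {..<k}}"

lemma finite_words: "finite (words n k)"
  unfolding words_def using finite_lists_length_eq[of "{..<k}" n] by (simp add: conj_commute)

lemma card_words: "card (words n k) = k ^ n"
  unfolding words_def using card_lists_length_eq[of "{..<k}" n] by (simp add: conj_commute)

lemma words_0: "words 0 k = {[]}"
  by (auto simp: words_def)

lemma words_Suc: "words (Suc n) k = (\<lambda>(w, a). a # w) ` (words n k \<times> {..<k})"
proof (intro set_eqI iffI)
  fix w assume "w \<in> words (Suc n) k"
  then obtain a v where "w = a # v" "v \<in> words n k" "a < k"
    by (cases w) (auto simp: words_def)
  thus "w \<in> (\<lambda>(w, a). a # w) ` (words n k \<times> {..<k})" by force
qed (auto simp: words_def)

text \<open>
  The tower rule for the last letter read: the induction step for moments and characteristic functions.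
\<close>

lemma avg_words_Suc:
  "avg (words (Suc n) k) F = avg (words n k) (\<lambda>w. avg {..<k} (\<lambda>a. F (a # w)))"
proof -
  have inj: "inj_on (\<lambda>(w, a). a # w) (words n k \<times> {..<k})"
    by (auto simp: inj_on_def)
  have "sum F (words (Suc n) k) = (\<Sum>w\<in>words n k. \<Sum>a<k. F (a # w))"
    unfolding words_Suc sum.reindex[OF inj] by (simp add: sum.cartesian_product case_prod_beta o_def)
  thus ?thesis
    by (simp add: avg_def card_words sum_divide_distrib[symmetric])
qed

lemma words_nonempty: "0 < k \<Longrightarrow> words n k \<noteq> {}"
  using card_words[of n k] by force

section \<open>The recency order and the move-to-front position\<close>

text \<open>
  Ranks determine the elements, because the predecessors of a smaller element form a strictly smaller
  set. This is applied to the recency order on all letters and to the natural order on the letters not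
  read so far.
\<close>

lemma bij_betw_strict_rank:
  assumes fin: "finite M"
    and irrefl: "\<And>a. a \<in> M \<Longrightarrow> \<not> R a a"
    and trans: "\<And>a b c. R a b \<Longrightarrow> R b c \<Longrightarrow> R a c"
    and total: "\<And>a b. a \<in> M \<Longrightarrow> b \<in> M \<Longrightarrow> a \<noteq> b \<Longrightarrow> R a b \<or> R b a"
  shows "bij_betw (\<lambda>c. card {b \<in> M. R b c}) M {..<card M}"
proof -
  have less: "card {b \<in> M. R b a} < card {b \<in> M. R b c}" if "a \<in> M" "R a c" for a c
  proof (rule psubset_card_mono)
    have "a \<in> {b \<in> M. R b c}" "a \<notin> {b \<in> M. R b a}" using that irrefl by auto
    moreover have "{b \<in> M. R b a} \<subseteq> {b \<in> M. R b c}" using that trans by blast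
    ultimately show "{b \<in> M. R b a} \<subset> {b \<in> M. R b c}" by blast
  qed (use fin in simp)
  have inj: "inj_on (\<lambda>c. card {b \<in> M. R b c}) M"
  proof (rule inj_onI)
    fix a c assume "a \<in> M" "c \<in> M" "card {b \<in> M. R b a} = card {b \<in> M. R b c}"
    thus "a = c" using less[of a c] less[of c a] total[of a c] by (metis less_irrefl_nat)
  qed
  moreover have "card {b \<in> M. R b c} < card M" if "c \<in> M" for c
    using that irrefl fin by (intro psubset_card_mono) auto
  ultimately have "(\<lambda>c. card {b \<in> M. R b c}) ` M = {..<card M}"
    by (intro card_subset_eq) (auto simp: card_image)
  thus ?thesis using inj by (rule bij_betw_imageI[rotated])
qed

text \<open>
  The order of the move-to-front list: it starts as \<open>0, 1, 2, ...\<close>, and every letter read moves to the front.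
\<close>

fun more_recent :: "nat list \<Rightarrow> nat \<Rightarrow> nat \<Rightarrow> bool" where
  "more_recent [] b c = (b < c)"
| "more_recent (x # w) b c = (c \<noteq> x \<and> (b = x \<or> more_recent w b c))"

lemma more_recent_irrefl: "\<not> more_recent w b b"
  by (induction w) auto

lemma more_recent_trans: "more_recent w a b \<Longrightarrow> more_recent w b c \<Longrightarrow> more_recent w a c"
  by (induction w) auto

lemma more_recent_total: "a \<noteq> b \<Longrightarrow> more_recent w a b \<or> more_recent w b a"
  by (induction w) auto

lemma more_recent_unseen:
  "c \<notin> set w \<Longrightarrow> more_recent w b c \<longleftrightarrow> b \<in> set w \<or> b < c"
  by (induction w) auto

lemma more_recent_seen:
  "c \<notin> set u \<Longrightarrow> more_recent (u @ c # v) b c \<longleftrightarrow> b \<in> set u"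
  by (induction u) auto

definition mtf_pos :: "nat \<Rightarrow> nat list \<Rightarrow> nat \<Rightarrow> nat" where
  "mtf_pos k w c = card {b \<in> {..<k}. more_recent w b c}"

text \<open>
  The source of independence: given any past, a uniform next letter has a uniform position.
\<close>

lemma bij_betw_mtf_pos: "bij_betw (mtf_pos k w) {..<k} {..<k}"
  using bij_betw_strict_rank[of "{..<k}" "more_recent w"]
    more_recent_irrefl more_recent_trans more_recent_total
  unfolding mtf_pos_def[abs_def] by (metis card_lessThan finite_lessThan)

fun mtf_sum :: "nat \<Rightarrow> nat list \<Rightarrow> nat" where
  "mtf_sum k [] = 0"
| "mtf_sum k (c # w) = mtf_pos k w c + mtf_sum k w"

definition new_rank :: "nat list \<Rightarrow> nat \<Rightarrow> nat" where
  "new_rank w c = card {b. b < c \<and> b \<notin> set w}"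

text \<open>
  A letter not read so far sits behind all letters read, at a place given by its rank among the
  unread ones. For a uniform unread letter this rank is uniform on \<open>{0..<k - d}\<close>, where \<open>d\<close> is the number of
  distinct letters read; its mean \<open>(k - d - 1) / 2\<close> is subtracted here.
\<close>

definition new_excess :: "nat \<Rightarrow> nat list \<Rightarrow> nat \<Rightarrow> real" where
  "new_excess k w c =
     (if c \<in> set w then 0 else real (new_rank w c) - (real k - real (card (set w)) - 1) / 2)"

text \<open>
  For a word that uses all \<open>k\<close> letters, the ranks add up to the number of inversions of the order of first
  appearance, and their means to \<open>k * (k - 1) / 4\<close>.
\<close>

fun new_noise :: "nat \<Rightarrow> nat list \<Rightarrow> real" where
  "new_noise k [] = 0"
| "new_noise k (c # w) = new_noise k w + new_excess k w c"

text \<open>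
  Time runs from right to left in a list, so \<open>u\<close> is the later part of the word: every \<open>c\<close> precedes every \<open>b\<close>.
\<close>

definition separated :: "nat list \<Rightarrow> nat \<Rightarrow> nat \<Rightarrow> bool" where
  "separated w c b \<longleftrightarrow>
     (\<exists>u v. w = u @ v \<and> b \<in> set u \<and> c \<notin> set u \<and> b \<notin> set v \<and> c \<in> set v)"

lemma separated_Cons:
  "separated (x # w) c b \<longleftrightarrow> c \<noteq> x \<and> (separated w c b \<or> b = x \<and> x \<notin> set w \<and> c \<in> set w)"
  (is "?L \<longleftrightarrow> ?R")
proof
  assume ?L
  then obtain u v where uv: "x # w = u @ v" "b \<in> set u" "c \<notin> set u" "b \<notin> set v" "c \<in> set v"
    unfolding separated_def by blast
  then obtain u' where u: "u = x # u'" "w = u' @ v" by (cases u) auto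
  show ?R
  proof (cases "b \<in> set u'")
    case True
    thus ?thesis using uv u unfolding separated_def by auto
  next
    case False
    thus ?thesis using uv u by auto
  qed
next
  assume R: ?R
  show ?L
  proof (cases "separated w c b")
    case True
    then obtain u v where "w = u @ v" "b \<in> set u" "c \<notin> set u" "b \<notin> set v" "c \<in> set v"
      unfolding separated_def by blast
    thus ?thesis using R unfolding separated_def by (intro exI[of _ "x # u"] exI[of _ v]) auto
  next
    case False
    thus ?thesis using R unfolding separated_def by (intro exI[of _ "[x]"] exI[of _ w]) auto
  qed
qed

lemma separated_seen:
  assumes "c \<notin> set u"
  shows "separated (u @ c # v) c b \<longleftrightarrow> b \<in> set u - set v"
  using assms by (induction u) (auto simp: separated_Cons)

definition separated_pairs :: "nat list \<Rightarrow> (nat \<times> nat) set" where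
  "separated_pairs w = {(c, b). separated w c b}"

lemma separated_pairs_subset: "separated_pairs w \<subseteq> set w \<times> set w"
  by (auto simp: separated_pairs_def separated_def)

lemma finite_separated_pairs: "finite (separated_pairs w)"
  by (rule finite_subset[OF separated_pairs_subset]) simp

text \<open>
  Reading \<open>c\<close> again destroys the separated pairs in which \<open>c\<close> comes first, and no others; \<open>u\<close> is the part of the word
  after the last \<open>c\<close>, so the second letters of these pairs occur in \<open>u\<close> but not in \<open>v\<close>.
\<close>

lemma card_separated_pairs_seen:
  fixes u v :: "nat list"
  assumes "c \<notin> set u"
  defines "w \<equiv> u @ c # v"
  shows "card (separated_pairs w) = card (separated_pairs (c # w)) + card (set u - set v)"
proof -
  have "separated_pairs w = separated_pairs (c # w) \<union> Pair c ` (set u - set v)"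
    using separated_seen[OF assms(1), of v] separated_Cons[of c w]
    by (auto simp: separated_pairs_def w_def)
  moreover have "separated_pairs (c # w) \<inter> Pair c ` (set u - set v) = {}"
    using separated_Cons[of c w] by (auto simp: separated_pairs_def)
  ultimately show ?thesis
    by (simp add: card_Un_disjoint finite_separated_pairs card_image inj_on_def)
qed

text \<open>
  A letter that appears for the first time comes after all letters that have occurred.
\<close>

lemma card_separated_pairs_new:
  assumes "c \<notin> set w"
  shows "card (separated_pairs (c # w)) = card (separated_pairs w) + card (set w)"
proof -
  have "separated_pairs (c # w) = separated_pairs w \<union> (\<lambda>b. (b, c)) ` set w"
    using assms separated_Cons[of c w] separated_pairs_subset[of w]
    by (auto simp: separated_pairs_def)
  moreover have "separated_pairs w \<inter> (\<lambda>b. (b, c)) ` set w = {}"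
    using assms separated_pairs_subset[of w] by auto
  ultimately show ?thesis
    by (simp add: card_Un_disjoint finite_separated_pairs card_image inj_on_def)
qed

lemma mtf_pos_seen:
  assumes "c \<notin> set u" "set u \<subseteq> {..<k}"
  shows "mtf_pos k (u @ c # v) c = card (set u)"
proof -
  have "{b \<in> {..<k}. more_recent (u @ c # v) b c} = set u"
    using assms more_recent_seen[OF assms(1)] by auto
  thus ?thesis by (simp add: mtf_pos_def)
qed

lemma mtf_pos_new:
  assumes "c \<notin> set w" "set w \<subseteq> {..<k}" "c < k"
  shows "mtf_pos k w c = card (set w) + new_rank w c"
proof -
  have "{b \<in> {..<k}. more_recent w b c} = set w \<union> {b. b < c \<and> b \<notin> set w}"
    using assms more_recent_unseen[OF assms(1)] by auto
  thus ?thesis unfolding mtf_pos_def new_rank_def by (simp add: card_Un_disjoint disjoint_iff)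
qed

section \<open>Crossings of the partition into letter classes\<close>

text \<open>
  Positions are numbered from 1 in the order of reading, hence against the order of list indices.
\<close>

definition positions :: "nat list \<Rightarrow> nat \<Rightarrow> nat set" where
  "positions w b = {p. 1 \<le> p \<and> p \<le> length w \<and> w ! (length w - p) = b}"

definition fibers :: "nat list \<Rightarrow> nat set set" where
  "fibers w = positions w ` set w"

lemma positions_Nil: "positions [] b = {}"
  by (auto simp: positions_def)

lemma positions_Cons:
  "positions (c # w) b = positions w b \<union> (if b = c then {Suc (length w)} else {})"
proof (intro set_eqI)
  fix p
  show "p \<in> positions (c # w) b \<longleftrightarrow> p \<in> positions w b \<union> (if b = c then {Suc (length w)} else {})"
    by (cases "p \<le> length w") (auto simp: positions_def Suc_diff_le le_Suc_eq)
qed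

lemma positions_append:
  "positions (u @ v) b = positions v b \<union> (+) (length v) ` positions u b"
  by (induction u) (auto simp: positions_Nil positions_Cons)

lemma positions_bounds: "p \<in> positions w b \<Longrightarrow> 1 \<le> p \<and> p \<le> length w"
  by (auto simp: positions_def)

lemma finite_positions: "finite (positions w b)"
  by (rule finite_subset[of _ "{1..length w}"]) (auto simp: positions_def)

lemma positions_nonempty_iff: "positions w b \<noteq> {} \<longleftrightarrow> b \<in> set w"
  by (induction w) (auto simp: positions_Nil positions_Cons)

lemma positions_disjoint: "p \<in> positions w b \<Longrightarrow> p \<in> positions w c \<Longrightarrow> b = c"
  by (auto simp: positions_def)

text \<open>
  The decomposition at the last occurrence of \<open>c\<close>: it has position \<open>Suc (length v)\<close>, the letters read before
  it are those of \<open>v\<close>, and the letters read after it are those of \<open>u\<close>.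
\<close>

lemma positions_last_split:
  assumes "w = u @ c # v" "c \<notin> set u"
  shows "Suc (length v) \<in> positions w c"
    and "p \<in> positions w c \<Longrightarrow> p \<le> Suc (length v)"
    and "b \<in> set v \<longleftrightarrow> (\<exists>p\<in>positions w b. p < Suc (length v))"
    and "b \<in> set u \<longleftrightarrow> (\<exists>p\<in>positions w b. Suc (length v) < p)"
proof -
  have w: "positions w b = positions v b \<union> (if b = c then {Suc (length v)} else {})
      \<union> (+) (Suc (length v)) ` positions u b" for b
    using positions_append[of u "c # v" b] by (simp add: assms(1) positions_Cons)
  show "Suc (length v) \<in> positions w c" by (simp add: w)
  show "p \<in> positions w c \<Longrightarrow> p \<le> Suc (length v)"
    using positions_nonempty_iff[of u c] assms(2) positions_bounds[of p v c] by (auto simp: w)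
  show "b \<in> set v \<longleftrightarrow> (\<exists>p\<in>positions w b. p < Suc (length v))"
  proof
    assume "b \<in> set v"
    then obtain q where "q \<in> positions v b" using positions_nonempty_iff[of v b] by blast
    thus "\<exists>p\<in>positions w b. p < Suc (length v)"
      using positions_bounds[of q v b] by (intro bexI[of _ q]) (auto simp: w)
  next
    assume "\<exists>p\<in>positions w b. p < Suc (length v)"
    then obtain p where "p \<in> positions w b" "p < Suc (length v)" by blast
    hence "positions v b \<noteq> {}" by (auto simp: w split: if_splits)
    thus "b \<in> set v" by (simp add: positions_nonempty_iff)
  qed
  show "b \<in> set u \<longleftrightarrow> (\<exists>p\<in>positions w b. Suc (length v) < p)"
  proof
    assume "b \<in> set u"
    then obtain q where "q \<in> positions u b" using positions_nonempty_iff[of u b] by blast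
    thus "\<exists>p\<in>positions w b. Suc (length v) < p"
      using positions_bounds[of q u b] by (intro bexI[of _ "Suc (length v) + q"]) (auto simp: w)
  next
    assume "\<exists>p\<in>positions w b. Suc (length v) < p"
    then obtain p where "p \<in> positions w b" "Suc (length v) < p" by blast
    hence "positions u b \<noteq> {}" using positions_bounds[of p v b] by (auto simp: w split: if_splits)
    thus "b \<in> set u" by (simp add: positions_nonempty_iff)
  qed
qed

lemma arcs_fibers_iff:
  "(i, j) \<in> arcs (fibers w) \<longleftrightarrow> i < j \<and> (\<exists>b. i \<in> positions w b \<and> j \<in> positions w b \<and>
     (\<forall>m\<in>positions w b. \<not> (i < m \<and> m < j)))"
  using positions_nonempty_iff[of w] by (auto simp: arcs_def fibers_def)

lemma arcs_fibers_bounds: "(i, j) \<in> arcs (fibers w) \<Longrightarrow> 1 \<le> i \<and> i < j \<and> j \<le> length w"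
  unfolding arcs_fibers_iff by (auto dest: positions_bounds)

text \<open>
  Reading \<open>c\<close> closes an arc that starts at the previous occurrence of \<open>c\<close>. The added set is a singleton if
  \<open>c\<close> has occurred and empty otherwise.
\<close>

lemma arcs_fibers_Cons:
  "arcs (fibers (c # w)) = arcs (fibers w) \<union>
     {(p, Suc (length w)) |p. p \<in> positions w c \<and> (\<forall>m\<in>positions w c. m \<le> p)}" (is "?L = ?R")
proof (intro set_eqI, clarify)
  fix i j
  show "(i, j) \<in> ?L \<longleftrightarrow> (i, j) \<in> ?R"
  proof (cases "j = Suc (length w)")
    case True
    have "(i, j) \<notin> arcs (fibers w)" using arcs_fibers_bounds[of i j w] True by auto
    moreover have "(i, j) \<in> ?L \<longleftrightarrow> i \<in> positions w c \<and> (\<forall>m\<in>positions w c. m \<le> i)"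
      unfolding arcs_fibers_iff positions_Cons True
      by (auto simp: not_less dest: positions_bounds split: if_splits) (force dest: positions_bounds)+
    ultimately show ?thesis using True by auto
  next
    case False
    have "(i, j) \<in> ?L \<longleftrightarrow> (i, j) \<in> arcs (fibers w)"
    proof -
      have out: "p \<notin> positions w b" if "length w < p" for p b
        using positions_bounds[of p w b] that by auto
      show ?thesis
      proof (cases "j \<le> length w")
        case True
        thus ?thesis unfolding arcs_fibers_iff positions_Cons by auto
      next
        case nle: False
        hence "j \<notin> positions w b" for b using out by simp
        thus ?thesis using False unfolding arcs_fibers_iff positions_Cons by auto
      qed
    qed
    thus ?thesis using False by auto
  qed
qed

definition crossing_pairs :: "nat set set \<Rightarrow> ((nat \<times> nat) \<times> (nat \<times> nat)) set" where
  "crossing_pairs P =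
     {((i, j), (i', j')). (i, j) \<in> arcs P \<and> (i', j') \<in> arcs P \<and> i < i' \<and> i' < j \<and> j < j'}"

lemma linear_crossings_eq: "linear_crossings P = card (crossing_pairs P)"
  by (simp add: linear_crossings_def crossing_pairs_def)

lemma finite_arcs_fibers: "finite (arcs (fibers w))"
proof (rule finite_subset)
  show "arcs (fibers w) \<subseteq> {1..length w} \<times> {1..length w}"
    by (auto dest: arcs_fibers_bounds)
qed simp

lemma finite_crossing_pairs: "finite (crossing_pairs (fibers w))"
proof (rule finite_subset)
  show "crossing_pairs (fibers w) \<subseteq> arcs (fibers w) \<times> arcs (fibers w)"
    by (auto simp: crossing_pairs_def)
qed (simp add: finite_arcs_fibers)

lemma linear_crossings_new:
  assumes "c \<notin> set w"
  shows "linear_crossings (fibers (c # w)) = linear_crossings (fibers w)"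
proof -
  have "positions w c = {}" using assms positions_nonempty_iff by blast
  hence "arcs (fibers (c # w)) = arcs (fibers w)" by (simp add: arcs_fibers_Cons)
  thus ?thesis by (simp add: linear_crossings_def)
qed

text \<open>
  The consecutive positions of a letter that occurs on both sides of a point (and not at it) jump over that
  point exactly once, so arcs over the last \<open>c\<close> correspond to letters.
\<close>

lemma card_arcs_over_last:
  assumes w: "w = u @ c # v" and c: "c \<notin> set u"
  shows "card {(i, j) \<in> arcs (fibers w). i < Suc (length v) \<and> Suc (length v) < j} = card (set u \<inter> set v)"
proof -
  define p where "p = Suc (length v)"
  define K where "K = {(i, j) \<in> arcs (fibers w). i < p \<and> p < j}"
  define letter where "letter = (\<lambda>(i::nat, j::nat). w ! (length w - i))"
  note split = positions_last_split[OF w c, folded p_def]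
  have letter: "letter (i, j) = b" if "i \<in> positions w b" for i j b
    using that by (simp add: letter_def positions_def)
  have "inj_on letter K"
  proof (rule inj_onI, clarify)
    fix i j i' j' assume K: "(i, j) \<in> K" "(i', j') \<in> K" and eq: "letter (i, j) = letter (i', j')"
    obtain b where b: "i \<in> positions w b" "j \<in> positions w b"
        "\<forall>m\<in>positions w b. \<not> (i < m \<and> m < j)" "i < p" "p < j"
      using K(1) by (auto simp: K_def arcs_fibers_iff)
    obtain b' where b': "i' \<in> positions w b'" "j' \<in> positions w b'"
        "\<forall>m\<in>positions w b'. \<not> (i' < m \<and> m < j')" "i' < p" "p < j'"
      using K(2) by (auto simp: K_def arcs_fibers_iff)
    have "b = b'" using eq letter b b' by simp
    hence "\<not> (i < i' \<and> i' < j)" "\<not> (i < j' \<and> j' < j)" "\<not> (i' < i \<and> i < j')" "\<not> (i' < j \<and> j < j')"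
      using b b' by blast+
    thus "i = i' \<and> j = j'" using b(4,5) b'(4,5) by linarith
  qed
  moreover have "letter ` K = set u \<inter> set v"
  proof (intro set_eqI iffI)
    fix b assume "b \<in> letter ` K"
    then obtain i j where K: "(i, j) \<in> K" and b: "b = letter (i, j)" by auto
    then obtain b' where "i \<in> positions w b'" "j \<in> positions w b'" "i < p" "p < j"
      by (auto simp: K_def arcs_fibers_iff)
    thus "b \<in> set u \<inter> set v" using b letter split(3,4)[of b] by auto
  next
    fix b assume b: "b \<in> set u \<inter> set v"
    define I where "I = {x \<in> positions w b. x < p}"
    define J where "J = {x \<in> positions w b. p < x}"
    have ne: "I \<noteq> {}" "J \<noteq> {}" using b split(3,4)[of b] by (auto simp: I_def J_def)
    have fin: "finite I" "finite J" using finite_positions by (auto simp: I_def J_def)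
    have "b \<noteq> c" using b c by auto
    hence p: "p \<notin> positions w b" using split(1) positions_disjoint by blast
    have I: "Max I \<in> I" and J: "Min J \<in> J" using ne fin by auto
    have "\<not> (Max I < m \<and> m < Min J)" if "m \<in> positions w b" for m
    proof -
      have "m \<in> I \<or> m \<in> J" using that p by (cases m p rule: linorder_cases) (auto simp: I_def J_def)
      thus ?thesis using Max_ge[OF fin(1), of m] Min_le[OF fin(2), of m] by fastforce
    qed
    hence "(Max I, Min J) \<in> K" using I J
      by (auto simp: K_def arcs_fibers_iff I_def[symmetric] J_def[symmetric])
        (auto simp: I_def J_def)
    moreover have "letter (Max I, Min J) = b" using I by (intro letter) (simp add: I_def)
    ultimately show "b \<in> letter ` K" by force
  qed
  ultimately have "card K = card (set u \<inter> set v)" using card_image[of letter K] by simp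
  thus ?thesis unfolding K_def p_def .
qed

text \<open>
  The arc closed by reading \<open>c\<close> has the largest right end, so it can only be the second arc of a
  crossing, and it is crossed exactly by the arcs over its left end, the last \<open>c\<close>.
\<close>

lemma linear_crossings_seen:
  assumes w: "w = u @ c # v" and c: "c \<notin> set u"
  shows "linear_crossings (fibers (c # w)) = linear_crossings (fibers w) + card (set u \<inter> set v)"
proof -
  define p n where "p = Suc (length v)" and "n = length w"
  define K where "K = {(i, j) \<in> arcs (fibers w). i < p \<and> p < j}"
  have "{(q, Suc (length w)) |q. q \<in> positions w c \<and> (\<forall>m\<in>positions w c. m \<le> q)} = {(p, Suc n)}"
    using positions_last_split(1,2)[OF w c] by (auto simp: p_def n_def intro: le_antisym)
  hence arcs: "arcs (fibers (c # w)) = insert (p, Suc n) (arcs (fibers w))"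
    by (simp add: arcs_fibers_Cons)
  have "crossing_pairs (fibers (c # w)) = crossing_pairs (fibers w) \<union> (\<lambda>a. (a, (p, Suc n))) ` K"
    unfolding crossing_pairs_def arcs
    by (auto simp: K_def n_def dest: arcs_fibers_bounds)
  moreover have "crossing_pairs (fibers w) \<inter> (\<lambda>a. (a, (p, Suc n))) ` K = {}"
    by (auto simp: crossing_pairs_def n_def dest: arcs_fibers_bounds)
  moreover have "finite K"
    unfolding K_def by (rule finite_subset[OF _ finite_arcs_fibers[of w]]) auto
  ultimately have "linear_crossings (fibers (c # w)) = linear_crossings (fibers w) + card K"
    unfolding linear_crossings_eq
    by (simp add: card_Un_disjoint finite_crossing_pairs card_image inj_on_def)
  thus ?thesis using card_arcs_over_last[OF w c] by (simp add: K_def p_def)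
qed

text \<open>
  The pathwise identity on which the proof rests. In terms of \<open>d = card (set w)\<close>, the last line collects,
  for the first appearance of each letter, the number \<open>d\<close> of letters ahead of it in the list, the \<open>d\<close> new
  separated pairs, and the mean rank \<open>(k - d - 1) / 2\<close> removed from the noise.
\<close>

lemma crossings_eq_mtf_sum:
  assumes "set w \<subseteq> {..<k}"
  shows "real (linear_crossings (fibers w)) =
    real (mtf_sum k w) + real (card (separated_pairs w)) - new_noise k w
    - (3 / 4 * real (card (set w)) * (real (card (set w)) - 1) + real (card (set w)) * (real k - 1) / 2)"
  using assms
proof (induction w)
  case Nil
  have "crossing_pairs (fibers []) = {}" by (auto simp: crossing_pairs_def arcs_def fibers_def)
  thus ?case by (simp add: linear_crossings_eq separated_pairs_def separated_def)
next
  case (Cons c w)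
  show ?case
  proof (cases "c \<in> set w")
    case True
    then obtain u v where w: "w = u @ c # v" and c: "c \<notin> set u" by (metis split_list_first)
    \<comment> \<open>The letters of \<open>u\<close> are those ahead of \<open>c\<close> in the list. Those that also occur in \<open>v\<close> give new
      crossings, and each of the others ends a separated pair.\<close>
    have u: "set u \<subseteq> {..<k}" using Cons.prems w by auto
    have "card (set u) = card (set u \<inter> set v) + card (set u - set v)"
      by (metis List.finite_set card_Int_Diff)
    thus ?thesis
      using Cons True linear_crossings_seen[OF w c] card_separated_pairs_seen[OF c, of v, folded w]
        mtf_pos_seen[OF c u, of v, folded w]
      by (simp add: insert_absorb new_excess_def)
  next
    case False
    \<comment> \<open>No crossing arises, and the position of \<open>c\<close> is \<open>card (set w)\<close> plus its rank among the unread letters.\<close>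
    define d where "d = real (card (set w))"
    have "real (card (set (c # w))) = d + 1" using False by (simp add: d_def)
    thus ?thesis
      using Cons False linear_crossings_new[OF False] card_separated_pairs_new[OF False]
        mtf_pos_new[OF False, of k]
      by (simp add: new_excess_def field_simps flip: d_def)
  qed
qed

section \<open>Moments and characteristic function of the move-to-front sum\<close>

lemma avg_words_Suc_le:
  fixes F G :: "nat list \<Rightarrow> real"
  assumes "\<And>w. w \<in> words n k \<Longrightarrow> avg {..<k} (\<lambda>a. F (a # w)) \<le> G w"
  shows "avg (words (Suc n) k) F \<le> avg (words n k) G"
  unfolding avg_words_Suc using assms by (rule avg_mono)

lemma sum_centred_lessThan: "(\<Sum>u<m. real u - (real m - 1) / 2) = 0"
proof -
  have "(\<Sum>u<m. real u) = real m * (real m - 1) / 2"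
    by (induction m) (auto simp: field_simps)
  thus ?thesis by (simp add: sum_subtractf)
qed

lemma avg_centred_square_lessThan:
  assumes "0 < k"
  shows "avg {..<k} (\<lambda>u. (real u - (real k - 1) / 2)\<^sup>2) = ((real k)\<^sup>2 - 1) / 12"
proof -
  have sq: "(\<Sum>u<m. (real u)\<^sup>2) = real m * (real m - 1) * (2 * real m - 1) / 6" for m
    by (induction m) (auto simp: field_simps power2_eq_square)
  have lin: "(\<Sum>u<m. real u) = real m * (real m - 1) / 2" for m
    by (induction m) (auto simp: field_simps)
  have "(\<Sum>u<k. (real u - (real k - 1) / 2)\<^sup>2)
      = (\<Sum>u<k. (real u)\<^sup>2 - (real k - 1) * real u + ((real k - 1) / 2)\<^sup>2)"
    by (intro sum.cong refl) (simp add: power2_eq_square field_simps)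
  also have "\<dots> = real k * (((real k)\<^sup>2 - 1) / 12)"
    by (simp add: sum.distrib sum_subtractf sum_distrib_left[symmetric] sq lin)
      (simp add: power2_eq_square field_simps)
  finally show ?thesis using assms by (simp add: avg_def)
qed

lemma avg_mtf_pos: "avg {..<k} (\<lambda>a. g (mtf_pos k w a)) = avg {..<k} g"
  using sum.reindex_bij_betw[OF bij_betw_mtf_pos, of g k w] by (simp add: avg_def)

definition mtf_dev :: "nat \<Rightarrow> nat list \<Rightarrow> real" where
  "mtf_dev k w = real (mtf_sum k w) - real (length w) * ((real k - 1) / 2)"

lemma mtf_dev_Nil: "mtf_dev k [] = 0"
  by (simp add: mtf_dev_def)

lemma mtf_dev_Cons: "mtf_dev k (c # w) = (real (mtf_pos k w c) - (real k - 1) / 2) + mtf_dev k w"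
  by (simp add: mtf_dev_def field_simps)

text \<open>
  Independence of the move-to-front positions, expressed by the factorization of the characteristic
  function.
\<close>

lemma avg_iexp_mtf_dev:
  "avg (words n k) (\<lambda>w. iexp (t * mtf_dev k w))
     = (avg {..<k} (\<lambda>u. iexp (t * (real u - (real k - 1) / 2)))) ^ n"
proof (induction n)
  case 0
  show ?case by (simp add: words_0 mtf_dev_Nil avg_def)
next
  case (Suc n)
  let ?\<phi> = "\<lambda>u. iexp (t * (real u - (real k - 1) / 2))"
  have "avg {..<k} (\<lambda>a. iexp (t * mtf_dev k (a # w))) = avg {..<k} ?\<phi> * iexp (t * mtf_dev k w)" for w
  proof -
    have "avg {..<k} (\<lambda>a. iexp (t * mtf_dev k (a # w)))
        = avg {..<k} (\<lambda>a. ?\<phi> (mtf_pos k w a) * iexp (t * mtf_dev k w))"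
      by (intro avg_cong) (simp add: mtf_dev_Cons distrib_left flip: exp_add)
    also have "\<dots> = avg {..<k} ?\<phi> * iexp (t * mtf_dev k w)"
      by (subst avg_multc, subst avg_mtf_pos[of k ?\<phi>], rule refl)
    finally show ?thesis .
  qed
  thus ?case by (simp only: avg_words_Suc avg_cmult Suc.IH power_Suc)
qed

lemma avg_centred_lessThan: "avg {..<k} (\<lambda>u. real u - (real k - 1) / 2) = 0"
  by (simp add: avg_def sum_centred_lessThan)

lemma avg_mtf_dev: "avg (words n k) (mtf_dev k) = 0"
proof (induction n)
  case 0
  show ?case by (simp add: words_0 mtf_dev_Nil avg_def)
next
  case (Suc n)
  have "avg {..<k} (\<lambda>a. mtf_dev k (a # w)) = (\<Sum>a<k. mtf_dev k w) / real k" for w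
    using avg_mtf_pos[of k "\<lambda>u. real u - (real k - 1) / 2" w] avg_centred_lessThan[of k]
    by (simp add: mtf_dev_Cons avg_add) (simp add: avg_def)
  hence "avg (words (Suc n) k) (mtf_dev k) = avg (words n k) (\<lambda>w. real k / real k * mtf_dev k w)"
    by (simp add: avg_words_Suc)
  thus ?case by (simp only: avg_cmult Suc.IH)
qed

lemma avg_mtf_dev_square:
  assumes "0 < k"
  shows "avg (words n k) (\<lambda>w. (mtf_dev k w)\<^sup>2) = real n * (((real k)\<^sup>2 - 1) / 12)"
proof (induction n)
  case 0
  show ?case by (simp add: words_0 mtf_dev_Nil avg_def)
next
  case (Suc n)
  define \<sigma>2 where "\<sigma>2 = ((real k)\<^sup>2 - 1) / 12"
  have "avg {..<k} (\<lambda>a. (mtf_dev k (a # w))\<^sup>2) = (mtf_dev k w)\<^sup>2 + \<sigma>2" for w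
  proof -
    let ?g = "\<lambda>u. (real u - (real k - 1) / 2)\<^sup>2 + 2 * mtf_dev k w * (real u - (real k - 1) / 2)
        + (mtf_dev k w)\<^sup>2"
    have "avg {..<k} (\<lambda>a. (mtf_dev k (a # w))\<^sup>2) = avg {..<k} (\<lambda>a. ?g (mtf_pos k w a))"
      unfolding mtf_dev_Cons power2_sum by (simp only: ac_simps)
    also have "\<dots> = avg {..<k} ?g" by (rule avg_mtf_pos)
    also have "\<dots> = \<sigma>2 + 2 * mtf_dev k w * 0 + (mtf_dev k w)\<^sup>2"
      using assms avg_centred_square_lessThan[OF assms] avg_centred_lessThan[of k]
      by (simp only: avg_add avg_cmult \<sigma>2_def) (simp add: avg_const lessThan_empty_iff)
    finally show ?thesis by simp
  qed
  thus ?case using assms Suc.IH words_nonempty[OF assms, of n]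
    by (simp add: avg_words_Suc avg_add avg_const finite_words \<sigma>2_def[symmetric] algebra_simps)
qed

lemma mtf_dev_bound:
  assumes "set w \<subseteq> {..<k}"
  shows "\<bar>mtf_dev k w\<bar> \<le> real (length w) * (real k / 2)"
  using assms
proof (induction w)
  case (Cons c w)
  have "mtf_pos k w c < k"
    using bij_betwE[OF bij_betw_mtf_pos[of k w]] Cons.prems by auto
  hence "\<bar>real (mtf_pos k w c) - (real k - 1) / 2\<bar> \<le> real k / 2"
    by (auto simp: abs_le_iff field_simps)
  moreover have "real (length (c # w)) * (real k / 2) = real k / 2 + real (length w) * (real k / 2)"
    by (simp add: distrib_right add_divide_distrib)
  ultimately show ?case
    using Cons abs_triangle_ineq[of "real (mtf_pos k w c) - (real k - 1) / 2" "mtf_dev k w"]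
    unfolding mtf_dev_Cons by simp
qed (simp add: mtf_dev_Nil)

section \<open>Moments of the error terms\<close>

text \<open>
  The second part bounds the square by \<open>k\<^sup>2 / 4\<close> times the indicator that \<open>a\<close> is new. The indicator is written
  as an increment of the number of distinct letters, so that its sum over time telescopes.
\<close>

lemma new_excess_centred:
  assumes w: "set w \<subseteq> {..<k}"
  shows "avg {..<k} (new_excess k w) = 0"
    and "a < k \<Longrightarrow> (new_excess k w a)\<^sup>2 \<le> (real k)\<^sup>2 / 4 * (real (card (set (a # w))) - real (card (set w)))"
proof -
  define M where "M = {..<k} - set w"
  have cardM: "card M = k - card (set w)" "card (set w) \<le> k"
    using w card_mono[OF finite_lessThan w] by (simp_all add: M_def card_Diff_subset)
  have \<xi>: "new_excess k w a = real (card {b \<in> M. b < a}) - (real (card M) - 1) / 2" if "a \<in> M" for a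
  proof -
    have "{b. b < a \<and> b \<notin> set w} = {b \<in> M. b < a}" using that by (auto simp: M_def)
    thus ?thesis using that cardM by (simp add: new_excess_def new_rank_def M_def of_nat_diff)
  qed
  have bij: "bij_betw (\<lambda>c. card {b \<in> M. b < c}) M {..<card M}"
    by (rule bij_betw_strict_rank) (auto simp: M_def)
  have "sum (new_excess k w) {..<k} = sum (new_excess k w) M"
    by (rule sum.mono_neutral_right) (auto simp: M_def new_excess_def)
  also have "\<dots> = (\<Sum>a\<in>M. real (card {b \<in> M. b < a}) - (real (card M) - 1) / 2)"
    by (rule sum.cong) (simp_all add: \<xi>)
  also have "\<dots> = (\<Sum>u<card M. real u - (real (card M) - 1) / 2)"
    by (rule sum.reindex_bij_betw[OF bij])
  finally show "avg {..<k} (new_excess k w) = 0" by (simp add: avg_def sum_centred_lessThan)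
  assume a: "a < k"
  show "(new_excess k w a)\<^sup>2 \<le> (real k)\<^sup>2 / 4 * (real (card (set (a # w))) - real (card (set w)))"
  proof (cases "a \<in> set w")
    case True
    thus ?thesis by (simp add: new_excess_def insert_absorb)
  next
    case False
    hence "a \<in> M" using a by (simp add: M_def)
    hence "card {b \<in> M. b < a} < card M" using bij_betwE[OF bij] by auto
    hence "\<bar>new_excess k w a\<bar> \<le> real k / 2"
      using \<xi>[OF \<open>a \<in> M\<close>] cardM by (auto simp: abs_le_iff field_simps)
    hence "(new_excess k w a)\<^sup>2 \<le> (real k / 2)\<^sup>2" by (metis abs_ge_zero power2_abs power_mono)
    thus ?thesis using False by (simp add: power_divide)
  qed
qed

text \<open>
  The noise is a martingale that moves only when a new letter appears, which happens at most \<open>k\<close> times,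
  and each step is at most \<open>k / 2\<close>. Formally, the square of the noise minus \<open>k\<^sup>2 / 4\<close> times the number of
  distinct letters is a supermartingale started at 0.
\<close>

lemma avg_new_noise_square_le:
  assumes k: "0 < k"
  shows "avg (words n k) (\<lambda>w. (new_noise k w)\<^sup>2) \<le> real k ^ 3 / 4"
proof -
  have "avg (words n k) (\<lambda>w. (new_noise k w)\<^sup>2 - (real k)\<^sup>2 / 4 * real (card (set w))) \<le> 0"
  proof (induction n)
    case 0
    show ?case by (simp add: words_0 avg_def)
  next
    case (Suc n)
    have "avg {..<k} (\<lambda>a. (new_noise k (a # w))\<^sup>2 - (real k)\<^sup>2 / 4 * real (card (set (a # w))))
        \<le> (new_noise k w)\<^sup>2 - (real k)\<^sup>2 / 4 * real (card (set w))" if "w \<in> words n k" for w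
    proof -
      define \<xi> where "\<xi> = new_excess k w"
      have w: "set w \<subseteq> {..<k}" using that by (simp add: words_def)
      note \<xi> = new_excess_centred[OF w, folded \<xi>_def]
      have "avg {..<k} (\<lambda>a. (new_noise k (a # w))\<^sup>2 - (real k)\<^sup>2 / 4 * real (card (set (a # w))))
          \<le> avg {..<k} (\<lambda>a. ((new_noise k w)\<^sup>2 - (real k)\<^sup>2 / 4 * real (card (set w)))
               + 2 * new_noise k w * \<xi> a)"
      proof (rule avg_mono)
        fix a assume a: "a \<in> {..<k}"
        have step: "new_noise k (a # w) = new_noise k w + \<xi> a" by (simp add: \<xi>_def)
        show "(new_noise k (a # w))\<^sup>2 - (real k)\<^sup>2 / 4 * real (card (set (a # w)))
            \<le> ((new_noise k w)\<^sup>2 - (real k)\<^sup>2 / 4 * real (card (set w))) + 2 * new_noise k w * \<xi> a"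
          using \<xi>(2)[of a] a unfolding step power2_sum right_diff_distrib lessThan_iff by linarith
      qed
      also have "\<dots> = (new_noise k w)\<^sup>2 - (real k)\<^sup>2 / 4 * real (card (set w))"
        using k \<xi>(1) by (simp only: avg_add avg_cmult) (simp add: avg_const lessThan_empty_iff)
      finally show ?thesis .
    qed
    hence "avg (words (Suc n) k) (\<lambda>w. (new_noise k w)\<^sup>2 - (real k)\<^sup>2 / 4 * real (card (set w)))
        \<le> avg (words n k) (\<lambda>w. (new_noise k w)\<^sup>2 - (real k)\<^sup>2 / 4 * real (card (set w)))"
      by (rule avg_words_Suc_le)
    thus ?case using Suc.IH by linarith
  qed
  hence "avg (words n k) (\<lambda>w. (new_noise k w)\<^sup>2) \<le> avg (words n k) (\<lambda>w. (real k)\<^sup>2 / 4 * real (card (set w)))"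
    by (simp add: avg_diff)
  also have "\<dots> \<le> avg (words n k) (\<lambda>_. (real k)\<^sup>2 / 4 * real k)"
  proof (intro avg_mono mult_left_mono)
    fix w assume "w \<in> words n k"
    thus "real (card (set w)) \<le> real k"
      using card_mono[of "{..<k}" "set w"] by (simp add: words_def)
  qed simp
  also have "\<dots> = real k ^ 3 / 4"
    using words_nonempty[OF k] by (simp add: avg_const finite_words power2_eq_square power3_eq_cube)
  finally show ?thesis .
qed

lemma card_words_omitting:
  assumes "b < k"
  shows "card {w. length w = n \<and> set w \<subseteq> {..<k} - {b}} = (k - 1) ^ n"
  using card_lists_length_eq[of "{..<k} - {b}" n] assms by (simp add: conj_commute)

lemma finite_words_omitting: "finite {w. length w = n \<and> set w \<subseteq> {..<k} - {b::nat}}"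
  using finite_lists_length_eq[of "{..<k} - {b}" n] by (simp add: conj_commute)

text \<open>
  A union bound over the point of time that separates \<open>c\<close> from \<open>b\<close>: before it \<open>b\<close> is forbidden, after it
  \<open>c\<close> is.
\<close>

lemma card_separated_words_le:
  assumes "b < k" "c < k"
  shows "card {w \<in> words n k. separated w c b} \<le> (n + 1) * (k - 1) ^ n"
proof -
  define L where "L b m = {w. length w = m \<and> set w \<subseteq> {..<k} - {b::nat}}" for b m
  have L: "finite (L b m)" for b m
    using finite_words_omitting by (simp add: L_def)
  have "{w \<in> words n k. separated w c b} \<subseteq> (\<Union>p\<le>n. (\<lambda>(u, v). u @ v) ` (L c p \<times> L b (n - p)))"
  proof
    fix w assume "w \<in> {w \<in> words n k. separated w c b}"
    then obtain u v where w: "w = u @ v" "length w = n" "set w \<subseteq> {..<k}" "c \<notin> set u" "b \<notin> set v"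
      by (auto simp: separated_def words_def)
    hence "length u \<le> n" "u \<in> L c (length u)" "v \<in> L b (n - length u)" by (auto simp: L_def)
    thus "w \<in> (\<Union>p\<le>n. (\<lambda>(u, v). u @ v) ` (L c p \<times> L b (n - p)))" using w(1) by force
  qed
  hence "card {w \<in> words n k. separated w c b}
      \<le> card (\<Union>p\<le>n. (\<lambda>(u, v). u @ v) ` (L c p \<times> L b (n - p)))"
    using L by (intro card_mono) auto
  also have "\<dots> \<le> (\<Sum>p\<le>n. card ((\<lambda>(u, v). u @ v) ` (L c p \<times> L b (n - p))))"
    by (rule card_UN_le) simp
  also have "\<dots> \<le> (\<Sum>p\<le>n. card (L c p \<times> L b (n - p)))"
    using L by (intro sum_mono card_image_le) auto
  also have "\<dots> = (\<Sum>p\<le>n. (k - 1) ^ n)"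
    using assms by (intro sum.cong) (auto simp: card_cartesian_product L_def card_words_omitting
      simp flip: power_add)
  finally show ?thesis by simp
qed

text \<open>
  There are at most \<open>k\<^sup>2\<close> pairs, so the square of their number is at most \<open>k\<^sup>2\<close> times the number, whose mean is
  at most \<open>k\<^sup>2\<close> times the bound for a single pair.
\<close>

lemma avg_card_separated_square_le:
  assumes "0 < k"
  shows "avg (words n k) (\<lambda>w. (real (card (separated_pairs w)))\<^sup>2)
     \<le> real k ^ 4 * (real n + 1) * ((real k - 1) / real k) ^ n"
proof -
  let ?K = "{..<k} \<times> {..<k}"
  have sub: "separated_pairs w \<subseteq> ?K" if "w \<in> words n k" for w
    using that separated_pairs_subset[of w] by (auto simp: words_def)
  have "(\<Sum>w\<in>words n k. card (separated_pairs w))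
      = (\<Sum>w\<in>words n k. \<Sum>x\<in>?K. of_bool (x \<in> separated_pairs w))"
  proof (rule sum.cong)
    fix w assume "w \<in> words n k"
    hence "separated_pairs w = ?K \<inter> separated_pairs w" using sub by blast
    thus "card (separated_pairs w) = (\<Sum>x\<in>?K. of_bool (x \<in> separated_pairs w))"
      by (simp add: sum_of_bool_eq Int_def)
  qed simp
  also have "\<dots> = (\<Sum>x\<in>?K. \<Sum>w\<in>words n k. of_bool (x \<in> separated_pairs w))"
    by (rule sum.swap)
  also have "\<dots> = (\<Sum>(c, b)\<in>?K. card {w \<in> words n k. separated w c b})"
    by (intro sum.cong) (auto simp: sum_of_bool_eq finite_words separated_pairs_def Int_def)
  also have "\<dots> \<le> (\<Sum>(c, b)\<in>?K. (n + 1) * (k - 1) ^ n)"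
    by (intro sum_mono) (use card_separated_words_le in auto)
  finally have total: "(\<Sum>w\<in>words n k. card (separated_pairs w)) \<le> k\<^sup>2 * ((n + 1) * (k - 1) ^ n)"
    by (simp add: power2_eq_square)
  have "(\<Sum>w\<in>words n k. (real (card (separated_pairs w)))\<^sup>2)
      \<le> (\<Sum>w\<in>words n k. (real k)\<^sup>2 * real (card (separated_pairs w)))"
  proof (rule sum_mono)
    fix w assume "w \<in> words n k"
    hence "card (separated_pairs w) \<le> k * k" using card_mono[OF _ sub] by fastforce
    hence "real (card (separated_pairs w)) \<le> (real k)\<^sup>2"
      by (simp add: power2_eq_square flip: of_nat_mult)
    thus "(real (card (separated_pairs w)))\<^sup>2 \<le> (real k)\<^sup>2 * real (card (separated_pairs w))"
      by (simp add: power2_eq_square[of "real (card _)"] mult_right_mono)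
  qed
  also have "\<dots> = (real k)\<^sup>2 * real (\<Sum>w\<in>words n k. card (separated_pairs w))"
    by (simp add: sum_distrib_left)
  also have "\<dots> \<le> (real k)\<^sup>2 * real (k\<^sup>2 * ((n + 1) * (k - 1) ^ n))"
    using total by (intro mult_left_mono of_nat_mono) auto
  also have "\<dots> = real k ^ 4 * (real n + 1) * (real k - 1) ^ n"
    using assms by (simp add: of_nat_diff power4_eq_xxxx power2_eq_square distrib_right)
  finally have "avg (words n k) (\<lambda>w. (real (card (separated_pairs w)))\<^sup>2)
      \<le> real k ^ 4 * (real n + 1) * (real k - 1) ^ n / real k ^ n"
    by (simp add: avg_def card_words divide_right_mono)
  thus ?thesis by (simp add: power_divide)
qed

definition onto_words :: "nat \<Rightarrow> nat \<Rightarrow> nat list set" where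
  "onto_words n k = {w. length w = n \<and> set w = {..<k}}"

lemma onto_words_subset: "onto_words n k \<subseteq> words n k"
  by (auto simp: onto_words_def words_def)

lemma finite_onto_words: "finite (onto_words n k)"
  using finite_subset[OF onto_words_subset finite_words] .

lemma card_not_onto_le:
  assumes "0 < k"
  shows "real (card (words n k - onto_words n k)) / real (card (words n k))
    \<le> real k * ((real k - 1) / real k) ^ n"
proof -
  have "words n k - onto_words n k \<subseteq> (\<Union>b<k. {w. length w = n \<and> set w \<subseteq> {..<k} - {b}})"
    by (auto simp: words_def onto_words_def)
  hence "card (words n k - onto_words n k) \<le> card (\<Union>b<k. {w. length w = n \<and> set w \<subseteq> {..<k} - {b}})"
    using finite_words_omitting by (intro card_mono) auto
  also have "\<dots> \<le> (\<Sum>b<k. card {w. length w = n \<and> set w \<subseteq> {..<k} - {b}})"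
    by (rule card_UN_le) simp
  also have "\<dots> = k * (k - 1) ^ n" by (simp add: card_words_omitting)
  finally have "real (card (words n k - onto_words n k)) \<le> real (k * (k - 1) ^ n)"
    by (rule of_nat_mono)
  also have "\<dots> = real k * (real k - 1) ^ n" using assms by (simp add: of_nat_diff)
  finally show ?thesis
    using assms by (simp add: card_words power_divide divide_right_mono)
qed

section \<open>From onto words to set partitions\<close>

lemma positions_eq_imp_eq:
  assumes "length w = length w'" "\<And>a. a \<in> set w \<Longrightarrow> positions w a = positions w' a"
  shows "w = w'"
proof (rule nth_equalityI)
  fix i assume i: "i < length w"
  have "length w - i \<in> positions w (w ! i)" using i by (auto simp: positions_def)
  hence "length w - i \<in> positions w' (w ! i)" using assms(2)[of "w ! i"] i by auto
  thus "w ! i = w' ! i" using i assms(1) by (simp add: positions_def)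
qed (use assms in simp)

lemma inj_on_positions: "inj_on (positions w) (set w)"
proof (rule inj_onI)
  fix a b assume "a \<in> set w" "positions w a = positions w b"
  thus "a = b" using positions_nonempty_iff[of w a] positions_disjoint[of _ w a b] by auto
qed

lemma fibers_in_set_partitions:
  assumes "w \<in> onto_words n k"
  shows "fibers w \<in> set_partitions n k"
proof -
  have w: "length w = n" "set w = {..<k}" using assms by (auto simp: onto_words_def)
  have "\<Union> (fibers w) = {1..n}"
  proof
    show "\<Union> (fibers w) \<subseteq> {1..n}"
    proof
      fix p assume "p \<in> \<Union> (fibers w)"
      then obtain b where "p \<in> positions w b" unfolding fibers_def by blast
      thus "p \<in> {1..n}" using positions_bounds[of p w b] w(1) by simp
    qed
    show "{1..n} \<subseteq> \<Union> (fibers w)"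
    proof
      fix p assume "p \<in> {1..n}"
      hence "p \<in> positions w (w ! (n - p))" "w ! (n - p) \<in> set w"
        using w(1) by (auto simp: positions_def)
      thus "p \<in> \<Union> (fibers w)" unfolding fibers_def by blast
    qed
  qed
  moreover have "disjoint (fibers w)"
    unfolding fibers_def disjoint_def using positions_disjoint[of _ w] by blast
  moreover have "{} \<notin> fibers w" using positions_nonempty_iff[of w] unfolding fibers_def by blast
  ultimately show ?thesis
    using w(2) card_image[OF inj_on_positions[of w]]
    by (simp add: set_partitions_def partition_on_def fibers_def)
qed

text \<open>
  A word with letter classes \<open>P\<close> is a labelling of the blocks of \<open>P\<close> by the letters: sending \<open>w\<close> to
  \<open>positions w\<close> is a bijection onto the injections of the alphabet into \<open>P\<close>, of which there are \<open>k!\<close>.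
\<close>

lemma card_words_with_fibers:
  assumes P: "P \<in> set_partitions n k"
  shows "card {w \<in> onto_words n k. fibers w = P} = (\<Prod>i<k. k - i)"
proof -
  have part: "partition_on {1..n} P" "card P = k" using P by (auto simp: set_partitions_def)
  have finP: "finite P" using part(1) by (rule finite_elements[rotated]) simp
  define H where "H = {h \<in> {..<k} \<rightarrow>\<^sub>E P. inj_on h {..<k}}"
  have "bij_betw (\<lambda>w. restrict (positions w) {..<k}) {w \<in> onto_words n k. fibers w = P} H"
  proof (rule bij_betw_imageI)
    show "inj_on (\<lambda>w. restrict (positions w) {..<k}) {w \<in> onto_words n k. fibers w = P}"
    proof (rule inj_onI, clarify)
      fix w w' assume w: "w \<in> onto_words n k" "w' \<in> onto_words n k"
        and eq: "restrict (positions w) {..<k} = restrict (positions w') {..<k}"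
      have "positions w a = positions w' a" if "a < k" for a
        using fun_cong[OF eq, of a] that by simp
      thus "w = w'" using w by (intro positions_eq_imp_eq) (auto simp: onto_words_def)
    qed
    show "(\<lambda>w. restrict (positions w) {..<k}) ` {w \<in> onto_words n k. fibers w = P} = H"
    proof (intro set_eqI iffI)
      fix h assume "h \<in> (\<lambda>w. restrict (positions w) {..<k}) ` {w \<in> onto_words n k. fibers w = P}"
      then obtain w where w: "set w = {..<k}" "fibers w = P" "h = restrict (positions w) {..<k}"
        by (auto simp: onto_words_def)
      have "inj_on h {..<k}" using inj_on_positions[of w] w by (simp add: inj_on_restrict_eq)
      moreover have "h \<in> {..<k} \<rightarrow>\<^sub>E P" using w by (auto simp: fibers_def)
      ultimately show "h \<in> H" by (simp add: H_def)
    next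
      fix h assume h: "h \<in> H"
      hence hP: "h ` {..<k} = P"
        using part(2) finP by (intro card_subset_eq) (auto simp: H_def card_image)
      have inj: "inj_on h {..<k}" using h by (simp add: H_def)
      have un: "\<Union> (h ` {..<k}) = {1..n}" using part(1) hP by (simp add: partition_on_def)
      have ex1: "\<exists>!a. a < k \<and> p \<in> h a" if p: "p \<in> {1..n}" for p
      proof -
        have "p \<in> \<Union> (h ` {..<k})" using un p by simp
        then obtain a where a: "a < k" "p \<in> h a" by blast
        have "b = a" if b: "b < k" "p \<in> h b" for b
        proof -
          have "h a \<in> P" "h b \<in> P" using hP a b by auto
          hence "h a = h b" using part(1) a b by (auto simp: partition_on_def disjoint_def)
          thus ?thesis using inj a b by (auto dest: inj_onD)
        qed
        thus ?thesis using a by blast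
      qed
      define g where "g p = (THE a. a < k \<and> p \<in> h a)" for p
      have g: "g p < k" "p \<in> h (g p)" if "p \<in> {1..n}" for p
        using theI'[OF ex1[OF that]] by (auto simp: g_def)
      have g_eq: "g p = a \<longleftrightarrow> p \<in> h a" if "p \<in> {1..n}" "a < k" for p a
        using ex1[OF that(1)] g[OF that(1)] that(2) by blast
      define w where "w = map (\<lambda>i. g (n - i)) [0..<n]"
      have len: "length w = n" by (simp add: w_def)
      have pos: "positions w a = h a" if "a < k" for a
      proof -
        have "h a \<subseteq> {1..n}" using un that by auto
        moreover have "p \<in> positions w a \<longleftrightarrow> p \<in> h a" if "p \<in> {1..n}" for p
          using that g_eq[OF that \<open>a < k\<close>] by (auto simp: positions_def w_def)
        moreover have "positions w a \<subseteq> {1..n}" using len by (auto dest: positions_bounds)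
        ultimately show ?thesis by blast
      qed
      have "set w = {..<k}"
      proof
        show "set w \<subseteq> {..<k}" using g(1) by (auto simp: w_def)
        show "{..<k} \<subseteq> set w"
        proof
          fix a assume "a \<in> {..<k}"
          moreover from this have "h a \<noteq> {}" using hP part(1) by (force simp: partition_on_def)
          ultimately show "a \<in> set w" using pos positions_nonempty_iff[of w a] by auto
        qed
      qed
      hence "w \<in> onto_words n k" "fibers w = P"
        using len pos hP by (auto simp: onto_words_def fibers_def)
      moreover have "restrict (positions w) {..<k} = h"
      proof (rule ext)
        fix a show "restrict (positions w) {..<k} a = h a"
          using pos h by (cases "a < k") (auto simp: H_def PiE_def extensional_def)
      qed
      ultimately show "h \<in> (\<lambda>w. restrict (positions w) {..<k}) ` {w \<in> onto_words n k. fibers w = P}"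
        by blast
    qed
  qed
  hence "card {w \<in> onto_words n k. fibers w = P} = card H" by (rule bij_betw_same_card)
  also have "\<dots> = (\<Prod>i<k. k - i)"
    using card_inj_on_subset_funcset[of "{..<k}" P "{..<k}"] finP part(2)
    by (simp add: H_def lessThan_atLeast0)
  finally show ?thesis .
qed

text \<open>
  All fibres of the map from onto words to partitions have the same size, so it maps the uniform
  distribution to the uniform distribution.
\<close>

lemma avg_onto_words_fibers:
  "avg (onto_words n k) (\<lambda>w. f (fibers w)) = avg (set_partitions n k) f"
proof -
  define N where "N = (\<Prod>i<k. k - i)"
  have N: "N > 0" by (auto simp: N_def prod_pos)
  have group: "(\<Sum>w\<in>onto_words n k. g (fibers w)) = of_nat N * sum g (set_partitions n k)"
    for g :: "nat set set \<Rightarrow> 'b::comm_semiring_1"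
  proof -
    have "(\<Sum>w\<in>onto_words n k. g (fibers w))
        = (\<Sum>P\<in>set_partitions n k. \<Sum>w\<in>{w \<in> onto_words n k. fibers w = P}. g (fibers w))"
      using fibers_in_set_partitions
      by (intro sum.group[symmetric] finite_onto_words finite_set_partitions) auto
    also have "\<dots> = (\<Sum>P\<in>set_partitions n k. of_nat N * g P)"
    proof (rule sum.cong)
      fix P assume "P \<in> set_partitions n k"
      from card_words_with_fibers[OF this]
      have "(\<Sum>w\<in>{w \<in> onto_words n k. fibers w = P}. g P) = of_nat N * g P"
        by (simp add: N_def)
      moreover have "(\<Sum>w\<in>{w \<in> onto_words n k. fibers w = P}. g (fibers w))
          = (\<Sum>w\<in>{w \<in> onto_words n k. fibers w = P}. g P)" by (rule sum.cong) auto
      ultimately show "(\<Sum>w\<in>{w \<in> onto_words n k. fibers w = P}. g (fibers w)) = of_nat N * g P"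
        by simp
    qed simp
    finally show ?thesis by (simp add: sum_distrib_left)
  qed
  have "card (onto_words n k) = N * card (set_partitions n k)"
    using group[of "\<lambda>_. 1::nat"] by simp
  thus ?thesis using group[of f] N by (simp add: avg_def)
qed
lemma expectation_uniform_set_partition:
  fixes f :: "nat set set \<Rightarrow> 'b::{banach, second_countable_topology, real_normed_field}"
  assumes "set_partitions n k \<noteq> {}"
  shows "measure_pmf.expectation (uniform_set_partition n k) f = avg (set_partitions n k) f"
proof -
  have "measure_pmf.expectation (uniform_set_partition n k) f
      = (\<Sum>P\<in>set_partitions n k. pmf (uniform_set_partition n k) P *\<^sub>R f P)"
    using assms finite_set_partitions
    by (intro integral_measure_pmf) (auto simp: uniform_set_partition_def set_pmf_of_set)
  also have "\<dots> = (\<Sum>P\<in>set_partitions n k. f P / of_nat (card (set_partitions n k)))"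
    using assms finite_set_partitions
    by (intro sum.cong) (auto simp: uniform_set_partition_def pmf_of_set scaleR_conv_of_real divide_inverse mult.commute)
  finally show ?thesis by (simp add: avg_def sum_divide_distrib)
qed

section \<open>Central limit theorem for the move-to-front sum\<close>

text \<open>
  The standard deviation of the sum of the move-to-front positions of a random word.
\<close>

definition mtf_sd :: "nat \<Rightarrow> nat \<Rightarrow> real" where
  "mtf_sd n k = sqrt (real n * (((real k)\<^sup>2 - 1) / 12))"

text \<open>
  For \<open>k \<ge> 2\<close> the variance has the order \<open>n * k\<^sup>2\<close>, which is the scale that error terms are compared with.
\<close>

lemma mtf_sd_square_ge:
  assumes "2 \<le> k"
  shows "real n * (real k)\<^sup>2 / 16 \<le> (mtf_sd n k)\<^sup>2"
proof -
  have "(2::real)\<^sup>2 \<le> (real k)\<^sup>2" using assms by (intro power_mono) auto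
  hence "(real k)\<^sup>2 / 16 \<le> ((real k)\<^sup>2 - 1) / 12" "0 \<le> ((real k)\<^sup>2 - 1) / 12" by simp_all
  thus ?thesis using mult_left_mono[of "(real k)\<^sup>2 / 16" "((real k)\<^sup>2 - 1) / 12" "real n"]
    by (simp add: mtf_sd_def)
qed

lemma mtf_sd_ge:
  assumes "2 \<le> k"
  shows "sqrt (real n) * real k / 4 \<le> mtf_sd n k"
proof -
  have "(2::real)\<^sup>2 \<le> (real k)\<^sup>2" using assms by (intro power_mono) auto
  hence "0 \<le> mtf_sd n k" by (simp add: mtf_sd_def)
  moreover have "(sqrt (real n) * real k / 4)\<^sup>2 \<le> (mtf_sd n k)\<^sup>2"
    using mtf_sd_square_ge[OF assms, of n] by (simp add: power_mult_distrib power_divide)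
  ultimately show ?thesis by (rule power2_le_imp_le[rotated])
qed

lemma mtf_sd_pos:
  assumes "2 \<le> k" "0 < n"
  shows "0 < mtf_sd n k"
proof (rule less_le_trans[OF _ mtf_sd_ge[OF assms(1)]])
  show "0 < sqrt (real n) * real k / 4" using assms by simp
qed

text \<open>
  The alphabet grows with \<open>n\<close>, so this is a central limit theorem for a triangular array. It is uniform
  in \<open>k\<close> because a centred position is at most \<open>k / 2\<close> in absolute value, that is, at most twice its standard
  deviation: the Taylor error of one factor is then at most \<open>(2 * \<bar>t\<bar> / sqrt n)^3 / 6\<close>, and \<open>n\<close> of these errors add
  up to \<open>O(1 / sqrt n)\<close>.
\<close>

lemma avg_iexp_mtf_dev_tendsto:
  assumes ev: "\<forall>\<^sub>F n in sequentially. 2 \<le> k n"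
  shows "(\<lambda>n. avg (words n (k n)) (\<lambda>w. iexp (t * (mtf_dev (k n) w / mtf_sd n (k n)))))
     \<longlonglongrightarrow> of_real (exp (- (t\<^sup>2) / 2))"
proof -
  define z where "z n = complex_of_real (1 + (- (t\<^sup>2) / 2) / real n)" for n
  have zlim: "(\<lambda>n. z n ^ n) \<longlonglongrightarrow> of_real (exp (- (t\<^sup>2) / 2))"
    unfolding z_def of_real_power[symmetric]
    by (rule tendsto_of_real[OF tendsto_exp_limit_sequentially[of "- (t\<^sup>2) / 2"]])
  have "\<forall>\<^sub>F n in sequentially. cmod (avg (words n (k n)) (\<lambda>w. iexp (t * (mtf_dev (k n) w / mtf_sd n (k n))))
       - z n ^ n) \<le> 8 * \<bar>t\<bar> ^ 3 / 6 * (1 / sqrt (real n))"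
    using ev eventually_ge_at_top[of "max 1 (nat \<lceil>t\<^sup>2 / 4\<rceil>)"]
  proof eventually_elim
    case (elim n)
    define K s where "K = k n" and "s = mtf_sd n K"
    have K: "2 \<le> K" and n: "1 \<le> n" "t\<^sup>2 / 4 \<le> real n" using elim by (auto simp: K_def nat_ceiling_le_eq)
    have s: "s > 0" using mtf_sd_pos K n by (simp add: s_def)
    define x where "x u = t / s * (real u - (real K - 1) / 2)" for u
    define \<phi> where "\<phi> = avg {..<K} (\<lambda>u. iexp (x u))"
    have power: "avg (words n K) (\<lambda>w. iexp (t * (mtf_dev K w / s))) = \<phi> ^ n"
      using avg_iexp_mtf_dev[of n K "t / s"] by (simp add: \<phi>_def x_def)
    have "cmod (\<phi> ^ n - z n ^ n) \<le> real n * cmod (\<phi> - z n)"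
    proof (rule norm_power_diff)
      show "cmod \<phi> \<le> 1" unfolding \<phi>_def
        using K by (intro norm_avg_le_bound) (auto simp: lessThan_empty_iff)
      have "\<bar>1 + (- (t\<^sup>2) / 2) / real n\<bar> \<le> 1" using n by (auto simp: abs_le_iff field_simps)
      thus "cmod (z n) \<le> 1" unfolding z_def norm_of_real .
    qed
    also have "real n * cmod (\<phi> - z n) \<le> real n * ((2 * \<bar>t\<bar> / sqrt (real n)) ^ 3 / 6)"
    proof (rule mult_left_mono)
      have mean: "avg {..<K} x = 0"
        unfolding x_def[abs_def] avg_cmult avg_centred_lessThan by simp
      have bound: "\<bar>x u\<bar> \<le> 2 * \<bar>t\<bar> / sqrt (real n)" if "u \<in> {..<K}" for u
      proof -
        have "\<bar>real u - (real K - 1) / 2\<bar> \<le> real K / 2"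
          using that by (auto simp: abs_le_iff field_simps)
        hence "\<bar>t\<bar> / s * \<bar>real u - (real K - 1) / 2\<bar> \<le> \<bar>t\<bar> / s * (real K / 2)"
          using s by (intro mult_left_mono) auto
        moreover have "\<bar>x u\<bar> = \<bar>t\<bar> / s * \<bar>real u - (real K - 1) / 2\<bar>"
          using s by (simp add: x_def abs_mult)
        ultimately have "\<bar>x u\<bar> \<le> \<bar>t\<bar> / s * (real K / 2)" by simp
        also have "\<dots> \<le> \<bar>t\<bar> / (sqrt (real n) * real K / 4) * (real K / 2)"
          using K n mtf_sd_ge[OF K, of n] s by (intro mult_right_mono divide_left_mono) (auto simp: s_def)
        also have "\<dots> = 2 * \<bar>t\<bar> / sqrt (real n)" using K by simp
        finally show ?thesis .
      qed
      have "avg {..<K} (\<lambda>u. (x u)\<^sup>2) = t\<^sup>2 / real n"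
      proof -
        define V where "V = ((real K)\<^sup>2 - 1) / 12"
        have "avg {..<K} (\<lambda>u. (x u)\<^sup>2) = (t / s)\<^sup>2 * V"
          using K avg_centred_square_lessThan[of K] unfolding x_def power_mult_distrib avg_cmult V_def by simp
        moreover have s2: "s\<^sup>2 = real n * V"
          using s unfolding s_def mtf_sd_def V_def by simp
        moreover have "V \<noteq> 0" using s s2 by auto
        ultimately show ?thesis by (simp add: power_divide)
      qed
      hence zn: "z n = of_real (1 - avg {..<K} (\<lambda>u. (x u)\<^sup>2) / 2)"
        by (simp add: z_def)
      show "cmod (\<phi> - z n) \<le> (2 * \<bar>t\<bar> / sqrt (real n)) ^ 3 / 6"
        unfolding \<phi>_def zn
      proof (rule avg_iexp_approx)
        show "{..<K} \<noteq> {}" using K by (auto simp: lessThan_empty_iff)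
      qed (simp_all add: mean bound)
    qed simp
    also have "\<dots> = 8 * \<bar>t\<bar> ^ 3 / 6 * (real n / (sqrt (real n)) ^ 3)"
      by (simp add: power_divide power_mult_distrib)
    also have "real n / (sqrt (real n)) ^ 3 = 1 / sqrt (real n)"
      using n by (simp add: power3_eq_cube)
    finally show ?case unfolding power[unfolded K_def s_def] .
  qed
  moreover have "(\<lambda>n. 8 * \<bar>t\<bar> ^ 3 / 6 * (1 / sqrt (real n))) \<longlonglongrightarrow> 0"
    by (intro tendsto_mult_right_zero) real_asymp
  ultimately have "(\<lambda>n. avg (words n (k n)) (\<lambda>w. iexp (t * (mtf_dev (k n) w / mtf_sd n (k n)))) - z n ^ n) \<longlonglongrightarrow> 0"
    by (rule Lim_null_comparison)
  from tendsto_add[OF this zlim] show ?thesis unfolding diff_add_cancel add_0_left .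
qed

section \<open>Asymptotic normality of the number of crossings\<close>

text \<open>
  The probability that a given letter is omitted is \<open>(1 - 1/k)^n \<le> exp (- n / k)\<close>, and the growth condition on \<open>k\<close>
  says \<open>n / k \<ge> 2 * ln n\<close>.
\<close>

lemma omission_probability_le:
  assumes "1 < n" "0 < k" "real k \<le> real n / (2 * ln (real n))"
  shows "((real k - 1) / real k) ^ n \<le> 1 / (real n)\<^sup>2"
proof -
  have "ln (real n) > 0" using assms by simp
  hence *: "2 * ln (real n) \<le> real n / real k" using assms by (simp add: field_simps)
  have "(real k - 1) / real k = 1 + (- 1 / real k)" using assms by (simp add: field_simps)
  also have "\<dots> \<le> exp (- 1 / real k)" by (rule exp_ge_add_one_self)
  finally have "((real k - 1) / real k) ^ n \<le> exp (- 1 / real k) ^ n"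
    using assms by (intro power_mono) auto
  also have "\<dots> = exp (- (real n / real k))" by (simp add: exp_of_nat_mult[symmetric])
  also have "\<dots> \<le> exp (- (2 * ln (real n)))" using * by simp
  also have "\<dots> = 1 / (real n)\<^sup>2"
    using assms by (simp add: exp_minus exp_double inverse_eq_divide)
  finally show ?thesis .
qed

text \<open>
  With \<open>d = k\<close> distinct letters the deterministic part of the pathwise identity is
  \<open>3/4 * k * (k - 1) + k * (k - 1) / 2\<close>.
\<close>

lemma crossings_onto_words:
  assumes w: "w \<in> onto_words n k"
  shows "real (linear_crossings (fibers w)) - (real n * ((real k - 1) / 2) - 5 / 4 * real k * (real k - 1))
     = mtf_dev k w + (real (card (separated_pairs w)) - new_noise k w)"
proof -
  have "length w = n" "set w = {..<k}" using w by (auto simp: onto_words_def)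
  moreover have "3 / 4 * real k * (real k - 1) + real k * (real k - 1) / 2 = 5 / 4 * real k * (real k - 1)"
    by simp
  ultimately show ?thesis
    using crossings_eq_mtf_sum[of w k] unfolding mtf_dev_def by simp
qed

text \<open>
  After division by the variance, which is at least \<open>n * k\<^sup>2 / 16\<close>, the separated pairs contribute the order
  \<open>(k / n)\<^sup>2\<close> and the noise of the first appearances the order \<open>k / n\<close>.
\<close>

lemma avg_onto_error_le:
  assumes n: "1 < n" and k: "2 \<le> k" "real k \<le> real n / (2 * ln (real n))"
    and half: "card (words n k) \<le> 2 * card (onto_words n k)" and ne: "onto_words n k \<noteq> {}"
  shows "avg (onto_words n k) (\<lambda>w. ((real (card (separated_pairs w)) - new_noise k w) / mtf_sd n k)\<^sup>2)
    \<le> 128 * (real k / real n)\<^sup>2 + 16 * (real k / real n)" (is "avg _ ?f \<le> _")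
proof -
  have k0: "0 < k" using k by simp
  define s2 where "s2 = (mtf_sd n k)\<^sup>2"
  have s2: "s2 > 0" using mtf_sd_pos[of k n] k n by (simp add: s2_def)
  have "avg (onto_words n k) ?f \<le> 2 * avg (words n k) ?f"
    using half ne by (intro avg_subset_le finite_words onto_words_subset) auto
  also have "avg (words n k) ?f \<le> avg (words n k)
      (\<lambda>w. (2 * (real (card (separated_pairs w)))\<^sup>2 + 2 * (new_noise k w)\<^sup>2) / s2)"
  proof (rule avg_mono)
    fix w
    have "(a - b)\<^sup>2 \<le> 2 * a\<^sup>2 + 2 * b\<^sup>2" for a b :: real
      using zero_le_power2[of "a + b"] by (simp add: power2_sum power2_diff)
    thus "?f w \<le> (2 * (real (card (separated_pairs w)))\<^sup>2 + 2 * (new_noise k w)\<^sup>2) / s2"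
      using s2 by (simp add: power_divide s2_def divide_right_mono)
  qed
  also have "\<dots> = (2 * avg (words n k) (\<lambda>w. (real (card (separated_pairs w)))\<^sup>2)
      + 2 * avg (words n k) (\<lambda>w. (new_noise k w)\<^sup>2)) / s2"
    by (simp only: avg_divide avg_add avg_cmult)
  also have "\<dots> \<le> (2 * (real k ^ 4 * (real n + 1) * (1 / (real n)\<^sup>2)) + 2 * (real k ^ 3 / 4)) / s2"
  proof (intro divide_right_mono add_mono mult_left_mono)
    have "avg (words n k) (\<lambda>w. (real (card (separated_pairs w)))\<^sup>2)
        \<le> real k ^ 4 * (real n + 1) * ((real k - 1) / real k) ^ n"
      by (rule avg_card_separated_square_le[OF k0])
    also have "\<dots> \<le> real k ^ 4 * (real n + 1) * (1 / (real n)\<^sup>2)"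
      using omission_probability_le[OF n k0 k(2)] by (intro mult_left_mono) auto
    finally show "avg (words n k) (\<lambda>w. (real (card (separated_pairs w)))\<^sup>2)
        \<le> real k ^ 4 * (real n + 1) * (1 / (real n)\<^sup>2)" .
    show "avg (words n k) (\<lambda>w. (new_noise k w)\<^sup>2) \<le> real k ^ 3 / 4"
      by (rule avg_new_noise_square_le[OF k0])
  qed (use s2 in auto)
  also have "\<dots> \<le> (2 * (real k ^ 4 * (2 * real n) * (1 / (real n)\<^sup>2)) + 2 * (real k ^ 3 / 4))
      / (real n * (real k)\<^sup>2 / 16)"
    using n k0 mtf_sd_square_ge[OF k(1), of n] s2
    by (intro frac_le add_mono mult_left_mono mult_right_mono add_nonneg_nonneg) (auto simp: s2_def)
  also have "\<dots> = 64 * (real k / real n)\<^sup>2 + 8 * (real k / real n)"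
    using n k0 by (simp add: field_simps power2_eq_square power3_eq_cube power4_eq_xxxx)
  finally show ?thesis by simp
qed

text \<open>
  Here \<open>T\<close> is the standardized move-to-front sum. Its limit law and first two moments are known for
  unconditioned words. They pass to onto words because \<open>1\<close>, \<open>\<bar>T\<bar>\<close> and \<open>T\<^sup>2\<close> are all \<open>O(n)\<close>, whereas the probability \<open>q\<close>
  of omitting a letter is at most \<open>r / n\<close>, where \<open>r = k / n\<close> tends to 0.
\<close>

lemma onto_words_iexp_tendsto:
  fixes k :: "nat \<Rightarrow> nat" and t :: real
  assumes ev: "\<forall>\<^sub>F n in sequentially. 2 \<le> k n \<and> real (k n) \<le> real n / (2 * ln (real n))"
  defines "A \<equiv> \<lambda>n. onto_words n (k n)"
    and "X \<equiv> \<lambda>w. real (linear_crossings (fibers w))"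
  shows "\<forall>\<^sub>F n in sequentially. A n \<noteq> {}"
    and "(\<lambda>n. avg (A n) (\<lambda>w. iexp (t * ((X w - avg (A n) X) / sqrt (avg (A n) (\<lambda>w. (X w - avg (A n) X)\<^sup>2))))))
      \<longlonglongrightarrow> of_real (exp (- (t\<^sup>2) / 2))"
proof -
  define W where "W n = words n (k n)" for n
  define r where "r n = real (k n) / real n" for n
  define s where "s n = mtf_sd n (k n)" for n
  define T where "T n w = mtf_dev (k n) w / s n" for n w
  define c where "c n = real n * ((real (k n) - 1) / 2) - 5 / 4 * real (k n) * (real (k n) - 1)" for n
  define q where "q n = real (card (W n - A n)) / real (card (W n))" for n
  have r: "r \<longlonglongrightarrow> 0"
  proof (rule Lim_null_comparison)
    show "\<forall>\<^sub>F n in sequentially. norm (r n) \<le> 1 / (2 * ln (real n))"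
      using ev eventually_gt_at_top[of 1]
    proof eventually_elim
      case (elim n)
      hence "real (k n) / real n \<le> real n / (2 * ln (real n)) / real n"
        by (intro divide_right_mono) auto
      thus ?case using elim by (simp add: r_def)
    qed
    show "(\<lambda>n. 1 / (2 * ln (real n))) \<longlonglongrightarrow> 0" by real_asymp
  qed
  have r_half: "\<forall>\<^sub>F n in sequentially. r n < 1 / 2" by (rule order_tendstoD(2)[OF r]) simp
  have good: "\<forall>\<^sub>F n in sequentially. 1 < n \<and> 2 \<le> k n \<and> real (k n) \<le> real n / (2 * ln (real n))
      \<and> real n * q n \<le> r n \<and> A n \<noteq> {} \<and> card (W n) \<le> 2 * card (A n)"
    using ev eventually_gt_at_top[of 1] r_half
  proof eventually_elim
    case (elim n)
    have "q n \<le> real (k n) * ((real (k n) - 1) / real (k n)) ^ n"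
      using elim card_not_onto_le[of "k n" n] by (simp add: q_def A_def W_def)
    also have "\<dots> \<le> real (k n) * (1 / (real n)\<^sup>2)"
      using elim omission_probability_le[of n "k n"] by (intro mult_left_mono) auto
    finally have "real n * q n \<le> real n * (real (k n) * (1 / (real n)\<^sup>2))" by (rule mult_left_mono) simp
    also have "\<dots> = r n" using elim by (simp add: r_def power2_eq_square)
    finally have q: "real n * q n \<le> r n" .
    moreover have "1 * q n \<le> real n * q n" using elim by (intro mult_right_mono) (auto simp: q_def)
    ultimately have "q n < 1 / 2" using elim by linarith
    moreover have W: "card (W n) > 0" using elim by (simp add: W_def card_words)
    ultimately have "2 * card (W n - A n) < card (W n)" by (simp add: q_def field_simps)
    moreover have "card (W n) = card (A n) + card (W n - A n)"
      using card_Diff_subset[OF finite_onto_words onto_words_subset, of n "k n"]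
        card_mono[OF finite_words onto_words_subset, of n "k n"] by (simp add: A_def W_def)
    ultimately have "card (W n) \<le> 2 * card (A n)" "card (A n) > 0" using W by linarith+
    thus ?case using elim q by (auto simp: card_gt_0_iff)
  qed
  show ne: "\<forall>\<^sub>F n in sequentially. A n \<noteq> {}" using good by (rule eventually_mono) simp
  have transfer: "\<forall>\<^sub>F n in sequentially. norm (avg (A n) (f n) - avg (W n) (f n)) \<le> 2 * C * r n"
    if C: "0 \<le> C" and f: "\<And>n w. 1 < n \<Longrightarrow> 2 \<le> k n \<Longrightarrow> w \<in> W n \<Longrightarrow> norm (f n w) \<le> C * real n"
    for f :: "nat \<Rightarrow> nat list \<Rightarrow> 'b::real_normed_field" and C
    using good
  proof eventually_elim
    case (elim n)
    have "norm (avg (A n) (f n) - avg (W n) (f n)) \<le> 2 * (C * real n) * q n"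
      unfolding q_def using elim f
      by (intro avg_subset_diff_le) (auto simp: W_def A_def finite_words onto_words_subset)
    also have "\<dots> = 2 * C * (real n * q n)" by simp
    also have "\<dots> \<le> 2 * C * r n" using elim C by (intro mult_left_mono) auto
    finally show ?case .
  qed
  have Clim: "(\<lambda>n. 2 * C * r n) \<longlonglongrightarrow> 0" for C by (rule tendsto_mult_right_zero[OF r])
  have T2: "(T n w)\<^sup>2 \<le> 4 * real n" if "1 < n" "2 \<le> k n" "w \<in> W n" for n w
  proof -
    have "\<bar>mtf_dev (k n) w\<bar> \<le> real n * (real (k n) / 2)"
      using mtf_dev_bound[of w "k n"] that by (simp add: W_def words_def)
    hence "(mtf_dev (k n) w)\<^sup>2 \<le> (real n * (real (k n) / 2))\<^sup>2" by (metis abs_ge_zero power2_abs power_mono)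
    hence "(T n w)\<^sup>2 \<le> (real n * (real (k n) / 2))\<^sup>2 / (real n * (real (k n))\<^sup>2 / 16)"
      unfolding T_def power_divide s_def using that mtf_sd_square_ge[of "k n" n] by (intro frac_le) auto
    also have "\<dots> = 4 * real n" using that by (simp add: power2_eq_square)
    finally show ?thesis .
  qed
  have WT2: "\<forall>\<^sub>F n in sequentially. avg (W n) (\<lambda>w. (T n w)\<^sup>2) = 1"
    using good
  proof eventually_elim
    case (elim n)
    have pos: "s n > 0" using mtf_sd_pos elim by (simp add: s_def)
    hence sq: "(s n)\<^sup>2 = real n * (((real (k n))\<^sup>2 - 1) / 12)"
      unfolding s_def mtf_sd_def by simp
    have "avg (W n) (\<lambda>w. (T n w)\<^sup>2) = (s n)\<^sup>2 / (s n)\<^sup>2"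
      using avg_mtf_dev_square[of "k n" n] elim
      unfolding sq W_def T_def power_divide avg_divide by simp
    thus ?case using pos by simp
  qed
  have WT: "avg (W n) (T n) = 0" for n
    using avg_mtf_dev[of n "k n"] by (simp add: T_def[abs_def] W_def avg_divide)
  show "(\<lambda>n. avg (A n) (\<lambda>w. iexp (t * ((X w - avg (A n) X) / sqrt (avg (A n) (\<lambda>w. (X w - avg (A n) X)\<^sup>2))))))
      \<longlonglongrightarrow> of_real (exp (- (t\<^sup>2) / 2))"
  proof (rule standardized_iexp_tendsto[where s = s and c = c and T = T and X = "\<lambda>_. X"])
    show "\<forall>\<^sub>F n in sequentially. finite (A n) \<and> A n \<noteq> {} \<and> 0 < s n"
      using good by (rule eventually_mono) (auto simp: A_def finite_onto_words s_def mtf_sd_pos)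
    show "(\<lambda>n. avg (A n) (\<lambda>w. ((X w - c n) / s n - T n w)\<^sup>2)) \<longlonglongrightarrow> 0"
    proof (rule Lim_null_comparison)
      show "\<forall>\<^sub>F n in sequentially. norm (avg (A n) (\<lambda>w. ((X w - c n) / s n - T n w)\<^sup>2))
          \<le> 128 * (r n)\<^sup>2 + 16 * r n"
        using good
      proof eventually_elim
        case (elim n)
        have "avg (A n) (\<lambda>w. ((X w - c n) / s n - T n w)\<^sup>2)
            = avg (A n) (\<lambda>w. ((real (card (separated_pairs w)) - new_noise (k n) w) / s n)\<^sup>2)"
        proof (rule avg_cong)
          fix w assume "w \<in> A n"
          hence "X w - c n = mtf_dev (k n) w + (real (card (separated_pairs w)) - new_noise (k n) w)"
            unfolding X_def c_def A_def by (rule crossings_onto_words)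
          thus "((X w - c n) / s n - T n w)\<^sup>2
              = ((real (card (separated_pairs w)) - new_noise (k n) w) / s n)\<^sup>2"
            by (simp add: T_def add_divide_distrib)
        qed
        also have "\<dots> \<le> 128 * (r n)\<^sup>2 + 16 * r n"
          unfolding A_def s_def r_def using elim
          by (intro avg_onto_error_le) (auto simp: A_def W_def)
        finally show ?case by (simp add: avg_nonneg)
      qed
      have "(\<lambda>n. 128 * (r n)\<^sup>2 + 16 * r n) \<longlonglongrightarrow> 128 * 0\<^sup>2 + 16 * 0" by (intro tendsto_intros r)
      thus "(\<lambda>n. 128 * (r n)\<^sup>2 + 16 * r n) \<longlonglongrightarrow> 0" by simp
    qed
    have "norm (T n w) \<le> 5 * real n" if "1 < n" "2 \<le> k n" "w \<in> W n" for n w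
    proof -
      \<comment> \<open>The linear bound on \<open>T\<^sup>2\<close> gives one on \<open>\<bar>T\<bar>\<close>, which is all that the transfer asks for.\<close>
      have "\<bar>T n w\<bar> \<le> 1 + (T n w)\<^sup>2"
        using zero_le_power2[of "\<bar>T n w\<bar> - 1"] by (simp add: power2_diff)
      thus ?thesis using T2[OF that] that by simp
    qed
    from Lim_null_comparison[OF transfer[of 5 T, OF _ this] Clim]
    show "(\<lambda>n. avg (A n) (T n)) \<longlonglongrightarrow> 0" by (simp add: WT)
    have lim: "(\<lambda>n. avg (A n) (\<lambda>w. (T n w)\<^sup>2) - avg (W n) (\<lambda>w. (T n w)\<^sup>2)) \<longlonglongrightarrow> 0"
      using Lim_null_comparison[OF transfer[of 4 "\<lambda>n w. (T n w)\<^sup>2"] Clim] T2 by simp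
    have "(\<lambda>n. avg (W n) (\<lambda>w. (T n w)\<^sup>2)) \<longlonglongrightarrow> 1" using WT2 by (rule tendsto_eventually)
    from tendsto_add[OF lim this] show "(\<lambda>n. avg (A n) (\<lambda>w. (T n w)\<^sup>2)) \<longlonglongrightarrow> 1" by simp
    have lim: "(\<lambda>n. avg (A n) (\<lambda>w. iexp (t * T n w)) - avg (W n) (\<lambda>w. iexp (t * T n w))) \<longlonglongrightarrow> 0"
      using Lim_null_comparison[OF transfer[of 1 "\<lambda>n w. iexp (t * T n w)"] Clim] by simp
    have "(\<lambda>n. avg (W n) (\<lambda>w. iexp (t * T n w))) \<longlonglongrightarrow> of_real (exp (- (t\<^sup>2) / 2))"
      unfolding W_def T_def s_def using ev by (intro avg_iexp_mtf_dev_tendsto) (auto elim: eventually_mono)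
    from tendsto_add[OF lim this]
    show "(\<lambda>n. avg (A n) (\<lambda>w. iexp (t * T n w))) \<longlonglongrightarrow> of_real (exp (- (t\<^sup>2) / 2))" by simp
  qed
qed

theorem theorem1p5:
  fixes k :: "nat \<Rightarrow> nat"
  assumes "\<forall>\<^sub>F n in sequentially. 2 \<le> k n \<and> real (k n) \<le> real n / (2 * ln (real n))"
  shows "weak_conv_m
    (\<lambda>n. distr (measure_pmf (uniform_set_partition n (k n))) borel
       (\<lambda>\<pi>. (real (linear_crossings \<pi>)
               - measure_pmf.expectation (uniform_set_partition n (k n)) (\<lambda>\<pi>. real (linear_crossings \<pi>)))
             / sqrt (measure_pmf.variance (uniform_set_partition n (k n)) (\<lambda>\<pi>. real (linear_crossings \<pi>)))))
    std_normal_distribution"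
proof (rule levy_continuity)
  show "real_distribution (distr (measure_pmf (uniform_set_partition n (k n))) borel
       (\<lambda>\<pi>. (real (linear_crossings \<pi>)
               - measure_pmf.expectation (uniform_set_partition n (k n)) (\<lambda>\<pi>. real (linear_crossings \<pi>)))
             / sqrt (measure_pmf.variance (uniform_set_partition n (k n)) (\<lambda>\<pi>. real (linear_crossings \<pi>)))))" for n
    by (intro prob_space.real_distribution_distr measure_pmf.prob_space_axioms) simp
  show "real_distribution std_normal_distribution" by (rule real_dist_normal_dist)
  fix t :: real
  let ?F = "\<lambda>n. \<lambda>\<pi>. (real (linear_crossings \<pi>)
               - measure_pmf.expectation (uniform_set_partition n (k n)) (\<lambda>\<pi>. real (linear_crossings \<pi>)))
             / sqrt (measure_pmf.variance (uniform_set_partition n (k n)) (\<lambda>\<pi>. real (linear_crossings \<pi>)))"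
  define A where "A n = onto_words n (k n)" for n
  define X where "X w = real (linear_crossings (fibers w))" for w
  note lim = onto_words_iexp_tendsto[OF assms, folded A_def X_def]
  have "\<forall>\<^sub>F n in sequentially.
      avg (A n) (\<lambda>w. iexp (t * ((X w - avg (A n) X) / sqrt (avg (A n) (\<lambda>w. (X w - avg (A n) X)\<^sup>2)))))
      = char (distr (measure_pmf (uniform_set_partition n (k n))) borel (?F n)) t"
    using lim(1)
  proof eventually_elim
    case (elim n)
    hence ne: "set_partitions n (k n) \<noteq> {}" using fibers_in_set_partitions by (auto simp: A_def)
    note expect = expectation_uniform_set_partition[OF ne] avg_onto_words_fibers[symmetric]
    have "char (distr (measure_pmf (uniform_set_partition n (k n))) borel (?F n)) t
        = measure_pmf.expectation (uniform_set_partition n (k n)) (\<lambda>\<pi>. iexp (t * ?F n \<pi>))"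
      by (simp add: char_def integral_distr)
    also have "\<dots> = avg (A n) (\<lambda>w. iexp (t * ((X w - avg (A n) X) / sqrt (avg (A n) (\<lambda>w. (X w - avg (A n) X)\<^sup>2)))))"
      by (simp add: expect A_def X_def[abs_def])
    finally show ?case by simp
  qed
  from Lim_transform_eventually[OF lim(2) this]
  show "(\<lambda>n. char (distr (measure_pmf (uniform_set_partition n (k n))) borel (?F n)) t)
      \<longlonglongrightarrow> char std_normal_distribution t"
    by (simp add: char_std_normal_distribution)
qed

end
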